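(* Let $(\mathscr{M};\mathcal{H})$, $(\mathscr{N};\mathcal{K})$ be represented von Neumann algebras and $\Phi:\mathscr{M}\to\mathscr{N}$ be a unital normal $*$-homomorphism. (i) The mapping $\Phi^s_{\mathrm{aff}}:\mathrm{Aff}_s(\mathscr{M})\to\mathrm{Aff}_s(\mathscr{N})$ given by $\mathrm{ran}(A)\mapsto\mathrm{ran}\big(\Phi(A)\big)$ for $A\in\mathscr{M}$ is a well-defined lattice homomorphism; (ii) $\Phi^s_{\mathrm{aff}}(\{0\}_{\mathcal{H}})=\{0\}_{\mathcal{K}}$ and $\Phi^s_{\mathrm{aff}}(\mathcal{H})=\mathcal{K}$; (iii) for all $\mathcal{V}\in\mathrm{Aff}_s(\mathscr{M})$, $\Phi^s_{\mathrm{aff}}\big(\overline{\mathcal{V}}\big)=\overline{\Phi^s_{\mathrm{aff}}(\mathcal{V})}$; (iv) if $\mathcal{V}\in\mathrm{Aff}_s(\mathscr{M})$ is dense in $\mathcal{H}$, then $\Phi^s_{\mathrm{aff}}(\mathcal{V})$ is dense in $\mathcal{K}$; (v) if $\mathcal{V},\mathcal{W}\in\mathrm{Aff}_s(\mathscr{M})$ are such that $\mathcal{V}\subseteq\mathcal{W}$, then $\Phi^s_{\mathrm{aff}}(\mathcal{V})\subseteq\Phi^s_{\mathrm{aff}}(\mathcal{W})$.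
   Context: A represented von Neumann algebra $(\mathscr{M};\mathcal{H})$ is a von Neumann algebra $\mathscr{M}$ acting on a complex Hilbert space $\mathcal{H}$; $\{0\}_{\mathcal{H}}$ is the zero subspace. $\mathrm{Aff}_s(\mathscr{M})$ is the set of (not necessarily closed) subspaces of $\mathcal{H}$ of the form $\mathrm{ran}(A)$ with $A\in\mathscr{M}$ (affiliated subspaces). It is a lattice with join the vector sum $\mathcal{V}+\mathcal{W}$ and meet the intersection $\mathcal{V}\cap\mathcal{W}$, and it contains $\overline{\mathcal{V}}$ whenever it contains $\mathcal{V}$. *)

theory Defs
  imports "HOL-Analysis.Analysis"
begin

section \<open>Complex Hilbert spaces\<close>

class scaleC =
  fixes scaleC :: "complex \<Rightarrow> 'a \<Rightarrow> 'a" (infixr \<open>*\<^sub>C\<close> 75)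

class complex_vector = scaleC + real_vector +
  assumes scaleC_add_right: "c *\<^sub>C (x + y) = c *\<^sub>C x + c *\<^sub>C y"
    and scaleC_add_left: "(c + d) *\<^sub>C x = c *\<^sub>C x + d *\<^sub>C x"
    and scaleC_scaleC: "c *\<^sub>C (d *\<^sub>C x) = (c * d) *\<^sub>C x"
    and scaleC_one: "1 *\<^sub>C x = x"
    and scaleR_scaleC: "r *\<^sub>R x = complex_of_real r *\<^sub>C x"

text \<open>The inner product is conjugate-linear in the first and linear in the second argument.\<close>

class complex_inner = complex_vector + real_normed_vector +
  fixes cinner :: "'a \<Rightarrow> 'a \<Rightarrow> complex"
  assumes cinner_commute: "cinner x y = cnj (cinner y x)"
    and cinner_add_right: "cinner x (y + z) = cinner x y + cinner x z"
    and cinner_scaleC_right: "cinner x (c *\<^sub>C y) = c * cinner x y"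
    and cinner_nonneg: "0 \<le> Re (cinner x x)"
    and cinner_eq_zero_iff: "cinner x x = 0 \<longleftrightarrow> x = 0"
    and norm_eq_sqrt_cinner: "norm x = sqrt (Re (cinner x x))"

class chilbert_space = complex_inner + complete_space

subclass (in chilbert_space) banach ..

lemma norm_scaleC: "norm (c *\<^sub>C x) = cmod c * norm (x :: 'a::complex_inner)"
proof -
  have "cinner (c *\<^sub>C x) y = cnj c * cinner x y" for y
    by (metis cinner_commute cinner_scaleC_right complex_cnj_mult)
  then have "cinner (c *\<^sub>C x) (c *\<^sub>C x) = complex_of_real ((cmod c)\<^sup>2) * cinner x x"
    by (metis cinner_scaleC_right complex_norm_square mult.assoc mult.commute)
  then show ?thesis
    by (simp add: norm_eq_sqrt_cinner real_sqrt_mult)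
qed

lemma bounded_linear_scaleC: "bounded_linear (\<lambda>x :: 'a::complex_inner. c *\<^sub>C x)"
proof (rule bounded_linear_intro[where K = "cmod c"])
  show "c *\<^sub>C (r *\<^sub>R x) = r *\<^sub>R (c *\<^sub>C x)" for r and x :: 'a
    by (simp add: scaleR_scaleC scaleC_scaleC mult.commute)
qed (simp_all add: scaleC_add_right norm_scaleC mult.commute)

section \<open>Bounded operators\<close>

text \<open>The library type \<open>'a \<Rightarrow>\<^sub>L 'a\<close> contains all bounded real-linear maps; the algebra of bounded
  operators on a complex Hilbert space is its subset of complex-linear maps, with composition
  \<open>o\<^sub>L\<close> as multiplication.\<close>

definition bounded_operators :: "('a::chilbert_space \<Rightarrow>\<^sub>L 'a) set" where
  "bounded_operators = {A. \<forall>c x. blinfun_apply A (c *\<^sub>C x) = c *\<^sub>C blinfun_apply A x}"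

instantiation blinfun :: (complex_inner, complex_inner) complex_vector
begin

lift_definition scaleC_blinfun :: "complex \<Rightarrow> 'a \<Rightarrow>\<^sub>L 'b \<Rightarrow> 'a \<Rightarrow>\<^sub>L 'b" is "\<lambda>c A x. c *\<^sub>C A x"
  by (rule bounded_linear_compose[OF bounded_linear_scaleC])

instance
  by standard
    (transfer; simp add: fun_eq_iff scaleC_add_right scaleC_add_left scaleC_scaleC scaleC_one
      scaleR_scaleC)+

end

definition adj :: "('a::chilbert_space \<Rightarrow>\<^sub>L 'a) \<Rightarrow> ('a \<Rightarrow>\<^sub>L 'a)" where
  "adj A = (THE B. \<forall>x y. cinner (blinfun_apply B x) y = cinner x (blinfun_apply A y))"

definition self_adjoint :: "('a::chilbert_space \<Rightarrow>\<^sub>L 'a) \<Rightarrow> bool" where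
  "self_adjoint A \<longleftrightarrow> A \<in> bounded_operators \<and> adj A = A"

definition positive_op :: "('a::chilbert_space \<Rightarrow>\<^sub>L 'a) \<Rightarrow> bool" where
  "positive_op A \<longleftrightarrow> A \<in> bounded_operators \<and> (\<forall>x. cinner x (blinfun_apply A x) \<in> \<real>\<^sub>\<ge>\<^sub>0)"

definition op_le :: "('a::chilbert_space \<Rightarrow>\<^sub>L 'a) \<Rightarrow> ('a \<Rightarrow>\<^sub>L 'a) \<Rightarrow> bool" where
  "op_le A B \<longleftrightarrow> positive_op (B - A)"

section \<open>Von Neumann algebras and their morphisms\<close>

definition commutant :: "('a::chilbert_space \<Rightarrow>\<^sub>L 'a) set \<Rightarrow> ('a \<Rightarrow>\<^sub>L 'a) set" where
  "commutant M = {B \<in> bounded_operators. \<forall>A\<in>M. A o\<^sub>L B = B o\<^sub>L A}"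

text \<open>A self-adjoint set of operators equal to its double commutant. Commutants
  are unital subalgebras, so the algebra axioms need not be listed.\<close>

definition von_neumann_algebra :: "('a::chilbert_space \<Rightarrow>\<^sub>L 'a) set \<Rightarrow> bool" where
  "von_neumann_algebra M \<longleftrightarrow>
     M \<subseteq> bounded_operators \<and> (\<forall>A\<in>M. adj A \<in> M) \<and> commutant (commutant M) = M"

definition unital_star_hom ::
  "('a::chilbert_space \<Rightarrow>\<^sub>L 'a) set \<Rightarrow> ('b::chilbert_space \<Rightarrow>\<^sub>L 'b) set \<Rightarrow>
    (('a \<Rightarrow>\<^sub>L 'a) \<Rightarrow> ('b \<Rightarrow>\<^sub>L 'b)) \<Rightarrow> bool" where
  "unital_star_hom M N \<Phi> \<longleftrightarrow>
     \<Phi> \<in> M \<rightarrow> N \<and>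
     (\<forall>A\<in>M. \<forall>B\<in>M. \<Phi> (A + B) = \<Phi> A + \<Phi> B) \<and>
     (\<forall>c. \<forall>A\<in>M. \<Phi> (c *\<^sub>C A) = c *\<^sub>C \<Phi> A) \<and>
     (\<forall>A\<in>M. \<forall>B\<in>M. \<Phi> (A o\<^sub>L B) = \<Phi> A o\<^sub>L \<Phi> B) \<and>
     (\<forall>A\<in>M. \<Phi> (adj A) = adj (\<Phi> A)) \<and>
     \<Phi> id_blinfun = id_blinfun"

definition is_op_sup ::
  "('a::chilbert_space \<Rightarrow>\<^sub>L 'a) set \<Rightarrow> ('a \<Rightarrow>\<^sub>L 'a) set \<Rightarrow> ('a \<Rightarrow>\<^sub>L 'a) \<Rightarrow> bool" where
  "is_op_sup M D S \<longleftrightarrow>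
     S \<in> M \<and> self_adjoint S \<and> (\<forall>A\<in>D. op_le A S) \<and>
     (\<forall>T\<in>M. self_adjoint T \<longrightarrow> (\<forall>A\<in>D. op_le A T) \<longrightarrow> op_le S T)"

text \<open>Normality: suprema of bounded increasing nets of self-adjoint elements are preserved. Nets are
  rendered as upward directed sets; boundedness is implied by the existence of a supremum.\<close>

definition normal_map ::
  "('a::chilbert_space \<Rightarrow>\<^sub>L 'a) set \<Rightarrow> ('b::chilbert_space \<Rightarrow>\<^sub>L 'b) set \<Rightarrow>
    (('a \<Rightarrow>\<^sub>L 'a) \<Rightarrow> ('b \<Rightarrow>\<^sub>L 'b)) \<Rightarrow> bool" where
  "normal_map M N \<Phi> \<longleftrightarrow>
     (\<forall>D S. D \<subseteq> {A \<in> M. self_adjoint A} \<and> D \<noteq> {} \<and>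
        (\<forall>A\<in>D. \<forall>B\<in>D. \<exists>C\<in>D. op_le A C \<and> op_le B C) \<and> is_op_sup M D S
        \<longrightarrow> is_op_sup N (\<Phi> ` D) (\<Phi> S))"

section \<open>Affiliated subspaces\<close>

definition aff_subspaces :: "('a::chilbert_space \<Rightarrow>\<^sub>L 'a) set \<Rightarrow> 'a set set" where
  "aff_subspaces M = {range (blinfun_apply A) | A. A \<in> M}"

text \<open>The assignment \<open>range A \<mapsto> range (\<Phi> A)\<close>, with \<open>A \<in> M\<close> chosen arbitrarily among the operators
  with the given range; that the choice is irrelevant is to be proved.\<close>

definition aff_map ::
  "('a::chilbert_space \<Rightarrow>\<^sub>L 'a) set \<Rightarrow> (('a \<Rightarrow>\<^sub>L 'a) \<Rightarrow> ('b::chilbert_space \<Rightarrow>\<^sub>L 'b)) \<Rightarrow>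
    'a set \<Rightarrow> 'b set" where
  "aff_map M \<Phi> V = range (blinfun_apply (\<Phi> (SOME A. A \<in> M \<and> range (blinfun_apply A) = V)))"

text \<open>Families of complex-linear subspaces that are lattices with respect to vector sum (here \<open>+\<close> on sets is
  pointwise addition) and intersection, and their homomorphisms.\<close>

definition sum_int_lattice :: "'a::complex_vector set set \<Rightarrow> bool" where
  "sum_int_lattice L \<longleftrightarrow>
     (\<forall>V\<in>L. subspace V \<and> (\<forall>c. \<forall>v\<in>V. c *\<^sub>C v \<in> V)) \<and>
     (\<forall>V\<in>L. \<forall>W\<in>L. V + W \<in> L \<and> V \<inter> W \<in> L)"

definition sum_int_lattice_hom ::
  "'a::complex_vector set set \<Rightarrow> 'b::complex_vector set set \<Rightarrow> ('a set \<Rightarrow> 'b set) \<Rightarrow> bool" where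
  "sum_int_lattice_hom L L' F \<longleftrightarrow>
     sum_int_lattice L \<and> sum_int_lattice L' \<and> F \<in> L \<rightarrow> L' \<and>
     (\<forall>V\<in>L. \<forall>W\<in>L. F (V + W) = F V + F W \<and> F (V \<inter> W) = F V \<inter> F W)"

end

theory Submission
  imports Defs
begin

text \<open>Factorisations carry everything. By Baire, \<open>range A \<subseteq> range B\<close> implies
  \<open>\<parallel>A\<^sup>* z\<parallel> \<le> K \<parallel>B\<^sup>* z\<parallel>\<close>, and then (Douglas) \<open>A = B C\<close> with \<open>C\<close> in the algebra; applying \<open>\<Phi>\<close> gives
  \<open>range (\<Phi> A) \<subseteq> range (\<Phi> B)\<close>. For contractions \<open>A\<close>, \<open>B\<close> let \<open>S\<^sup>2 = A A\<^sup>* + B B\<^sup>*\<close> with \<open>S\<close> self-adjoint, so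
  that \<open>A = S C\<close>, \<open>B = S D\<close> where \<open>C C\<^sup>* + D D\<^sup>*\<close> is the projection onto the closed range of \<open>S\<close>. Then
  \<open>range A + range B = range S\<close> and
  \<open>range A \<inter> range B = range (A (1 - C\<^sup>* C)) + range (A C\<^sup>* D)\<close>.
  These identities survive \<open>\<Phi>\<close> as soon as \<open>\<Phi>\<close> respects range projections. That is where
  normality enters: for a contraction \<open>A\<close> the range projection is the supremum of the increasing
  sequence \<open>1 - (1 - A A\<^sup>*)\<^sup>m\<close>.\<close>

section \<open>Inner products and a Riesz representation\<close>

lemma cinner_add_left: "cinner (x + y) z = cinner x z + cinner y z"
  by (metis cinner_add_right cinner_commute complex_cnj_add)

lemma cinner_scaleC_left: "cinner (c *\<^sub>C x) y = cnj c * cinner x y"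
  by (metis cinner_commute cinner_scaleC_right complex_cnj_mult)

lemma cinner_scaleR_right: "cinner x (r *\<^sub>R y) = of_real r * cinner x y"
  by (simp add: scaleR_scaleC cinner_scaleC_right)

lemma cinner_scaleR_left: "cinner (r *\<^sub>R x) y = of_real r * cinner x y"
  by (simp add: scaleR_scaleC cinner_scaleC_left)

lemma cinner_self: "cinner x x = of_real ((norm x)\<^sup>2)"
proof -
  have "Im (cinner x x) = 0"
    by (metis cinner_commute cnj.simps(2) neg_equal_zero)
  then show ?thesis
    by (simp add: complex_eq_iff norm_eq_sqrt_cinner cinner_nonneg)
qed

lemma cinner_Cauchy_Schwarz: "cmod (cinner x y) \<le> norm x * norm y"
proof (cases "x = 0")
  case True
  then show ?thesis
    using cinner_scaleR_left[of 0 x y] by simp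
next
  case False
  define a where "a = cinner x y"
  \<comment> \<open>Up to the factor \<open>(norm x)\<^sup>2\<close>, this is the component of
    \<open>y\<close> orthogonal to \<open>x\<close>; the scaling avoids a division.\<close>
  define v where "v = (norm x)\<^sup>2 *\<^sub>R y + (- a) *\<^sub>C x"
  have "cinner y x = cnj a"
    unfolding a_def by (rule cinner_commute)
  then have "cinner v v = of_real ((norm x)\<^sup>2 * ((norm x)\<^sup>2 * (norm y)\<^sup>2 - (cmod a)\<^sup>2))"
    unfolding v_def
    by (simp add: cinner_add_left cinner_add_right cinner_scaleC_left cinner_scaleC_right
        cinner_scaleR_left cinner_scaleR_right cinner_self[of x] cinner_self[of y] flip: a_def)
      (simp add: algebra_simps power2_eq_square
        flip: complex_norm_square[unfolded power2_eq_square])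
  then have "0 \<le> (norm x)\<^sup>2 * ((norm x)\<^sup>2 * (norm y)\<^sup>2 - (cmod a)\<^sup>2)"
    by (metis Re_complex_of_real cinner_nonneg)
  then have "(cmod a)\<^sup>2 \<le> (norm x * norm y)\<^sup>2"
    using False by (simp add: zero_le_mult_iff power_mult_distrib)
  then show ?thesis
    unfolding a_def by (rule power2_le_imp_le) simp
qed

lemma bounded_bilinear_cinner: "bounded_bilinear cinner"
proof
  show "\<exists>K. \<forall>a b. cmod (cinner a b) \<le> norm a * norm b * K"
    by (rule exI[of _ 1]) (simp add: cinner_Cauchy_Schwarz)
qed (simp_all add: cinner_add_left cinner_add_right cinner_scaleR_left cinner_scaleR_right
    scaleR_conv_of_real)

interpretation cinner: bounded_bilinear cinner
  by (rule bounded_bilinear_cinner)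

lemmas cinner_simps = cinner_add_left cinner_add_right cinner.diff_left cinner.diff_right
  cinner.minus_left cinner.minus_right

lemma cinner_ext_left: "(\<And>z. cinner x z = cinner y z) \<Longrightarrow> x = y"
  by (metis cinner.diff_left cinner_eq_zero_iff right_minus_eq)

lemma norm_add_square: "(norm (x + y))\<^sup>2 = (norm x)\<^sup>2 + 2 * Re (cinner x y) + (norm y)\<^sup>2"
proof -
  have "Re (cinner y x) = Re (cinner x y)"
    by (subst cinner_commute) simp
  moreover have "(norm (x + y))\<^sup>2 = Re (cinner (x + y) (x + y))"
    by (metis Re_complex_of_real cinner_self)
  ultimately show ?thesis
    by (simp add: cinner_simps cinner_self[of x] cinner_self[of y])
qed

lemma norm_diff_square: "(norm (x - y))\<^sup>2 = (norm x)\<^sup>2 - 2 * Re (cinner x y) + (norm y)\<^sup>2"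
  using norm_add_square[of x "- y"] by (simp add: cinner_simps)

lemma orthogonal_closure:
  assumes "y \<in> closure S" and "\<And>s. s \<in> S \<Longrightarrow> cinner x s = 0"
  shows "cinner x y = 0"
proof -
  obtain s where "\<And>n. s n \<in> S" and "s \<longlonglongrightarrow> y"
    using assms(1) unfolding closure_sequential by blast
  moreover from this have "(\<lambda>n. cinner x (s n)) \<longlonglongrightarrow> cinner x y"
    by (intro cinner.tendsto tendsto_const)
  ultimately show ?thesis
    using assms(2) by (simp add: LIMSEQ_const_iff)
qed

text \<open>\<open>x - y\<close> is orthogonal to the range, hence to its closure, which contains
  \<open>x\<close> and \<open>y\<close>; so it is orthogonal to itself. Linearity of the factors
  built below and their commutation relations rest on this uniqueness.\<close>

lemma closure_range_orthogonal_eq: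
  assumes "x \<in> closure (range R)" "y \<in> closure (range R)" "\<And>z. cinner x (R z) = cinner y (R z)"
  shows "x = y"
proof -
  have "cinner (x - y) (R z) = 0" for z
    by (simp add: cinner_simps assms(3))
  then have "cinner (x - y) x = 0" "cinner (x - y) y = 0"
    by (auto intro: orthogonal_closure assms(1,2))
  then show ?thesis
    by (metis cinner.diff_right cinner_eq_zero_iff eq_iff_diff_eq_0)
qed

lemma linear_perturbation_eq_0:
  fixes a b :: real
  assumes "0 \<le> b" "\<And>t. 0 \<le> 2 * t * a + t\<^sup>2 * b"
  shows "a = 0"
proof (rule ccontr)
  assume "a \<noteq> 0"
  \<comment> \<open>At \<open>t = - a / (b + 1)\<close> the linear term wins; the \<open>+ 1\<close>
    keeps the denominator positive when \<open>b = 0\<close>.\<close>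
  have "2 * (- a / (b + 1)) * a + (- a / (b + 1))\<^sup>2 * b = - (a\<^sup>2 * (b + 2)) / (b + 1)\<^sup>2"
    using assms(1) by (simp add: divide_simps) (simp add: power2_eq_square algebra_simps)
  also have "\<dots> < 0"
    using assms(1) \<open>a \<noteq> 0\<close> by (intro divide_neg_pos) (auto simp: zero_less_mult_iff)
  finally show False
    using assms(2)[of "- a / (b + 1)"] by linarith
qed

lemma bounded_operatorsD: "A \<in> bounded_operators \<Longrightarrow> A (c *\<^sub>C x) = c *\<^sub>C A x"
  by (simp add: bounded_operators_def)

text \<open>A sequence minimising \<open>(norm (R z))\<^sup>2 - 2 * Re (f z)\<close> has Cauchy
  images under \<open>R\<close>, and the vanishing first variation at the limit \<open>y\<close> of
  these images is the desired identity.\<close>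

lemma riesz_range:
  fixes R :: "'a::chilbert_space \<Rightarrow>\<^sub>L 'a"
  assumes R: "R \<in> bounded_operators"
    and add: "\<And>x y. f (x + y) = f x + f y" and scale: "\<And>c x. f (c *\<^sub>C x) = c * f x"
    and bound: "\<And>x. cmod (f x) \<le> K * norm (R x)"
  obtains y where "y \<in> closure (range R)" and "\<And>z. cinner y (R z) = f z"
proof -
  have scaleR: "f (r *\<^sub>R x) = of_real r * f x" for r x
    by (simp add: scaleR_scaleC scale)
  define J where "J z = (norm (R z))\<^sup>2 - 2 * Re (f z)" for z
  have below: "- K\<^sup>2 \<le> J z" for z
  proof -
    have "Re (f z) \<le> K * norm (R z)"
      using bound complex_Re_le_cmod order_trans by blast
    moreover have "0 \<le> (norm (R z) - K)\<^sup>2"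
      by simp
    ultimately show ?thesis
      by (simp add: J_def power2_diff mult.commute mult.left_commute)
  qed
  define j where "j = Inf (range J)"
  have j_le: "j \<le> J z" for z
    unfolding j_def by (rule cInf_lower[OF rangeI bdd_belowI2[OF below]])
  have "\<exists>z. J z < j + 1 / Suc n" for n
    using cInf_lessD[of "range J" "j + 1 / Suc n"] by (auto simp: j_def)
  then obtain z where z: "\<And>n. J (z n) < j + 1 / Suc n"
    by metis
  have var: "J (x + t *\<^sub>R v) = J x + 2 * t * (Re (cinner (R x) (R v)) - Re (f v)) + t\<^sup>2 * (norm (R v))\<^sup>2"
    for x t v
  proof -
    have "Re (f (x + t *\<^sub>R v)) = Re (f x) + t * Re (f v)"
      by (simp add: add scaleR)
    moreover have "(norm (R (x + t *\<^sub>R v)))\<^sup>2 =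
        (norm (R x))\<^sup>2 + 2 * t * Re (cinner (R x) (R v)) + t\<^sup>2 * (norm (R v))\<^sup>2"
      by (simp add: blinfun.add_right blinfun.scaleR_right norm_add_square cinner.scaleR_right
          power_mult_distrib)
    ultimately show ?thesis
      by (simp add: J_def algebra_simps)
  qed
  \<comment> \<open>The parallelogram law, with \<open>J \<ge> j\<close> at the midpoint:
    near-minimisers have nearby images under \<open>R\<close>.\<close>
  have parallelogram: "(norm (R x - R y))\<^sup>2 \<le> 2 * (J x - j) + 2 * (J y - j)" for x y
  proof -
    have "4 * J ((1/2) *\<^sub>R (x + y)) = (norm (R x + R y))\<^sup>2 - 4 * Re (f x) - 4 * Re (f y)"
      by (simp add: J_def blinfun.bilinear_simps add scaleR power_divide flip: scaleR_add_right)
        (simp add: field_simps)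
    then have "(norm (R x - R y))\<^sup>2 = 2 * J x + 2 * J y - 4 * J ((1/2) *\<^sub>R (x + y))"
      unfolding J_def[of x] J_def[of y] norm_add_square norm_diff_square by argo
    with j_le[of "(1/2) *\<^sub>R (x + y)"] show ?thesis
      by simp
  qed
  have "Cauchy (\<lambda>n. R (z n))"
  proof (rule metric_CauchyI)
    fix e :: real assume "e > 0"
    then obtain N where N: "4 / e\<^sup>2 < real N"
      using reals_Archimedean2 by blast
    moreover have "0 < 4 / e\<^sup>2"
      using \<open>e > 0\<close> by simp
    ultimately have "0 < real N"
      by linarith
    with N have N': "4 * (1 / real N) < e\<^sup>2"
      using \<open>e > 0\<close> by (simp add: field_simps)
    have "dist (R (z m)) (R (z n)) < e" if "m \<ge> N" "n \<ge> N" for m n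
    proof -
      have "1 / real (Suc m) \<le> 1 / N" "1 / real (Suc n) \<le> 1 / N"
        using that \<open>0 < real N\<close> by (auto intro!: divide_left_mono)
      then have "(norm (R (z m) - R (z n)))\<^sup>2 < e\<^sup>2"
        using parallelogram[of "z m" "z n"] z[of m] z[of n] N' by argo
      then show ?thesis
        using \<open>e > 0\<close> by (simp add: dist_norm power_less_imp_less_base)
    qed
    then show "\<exists>M. \<forall>m\<ge>M. \<forall>n\<ge>M. dist (R (z m)) (R (z n)) < e"
      by blast
  qed
  then obtain y where y: "(\<lambda>n. R (z n)) \<longlonglongrightarrow> y"
    using Cauchy_convergent convergent_def by blast
  \<comment> \<open>Compare \<open>J (z n + t *\<^sub>R v) \<ge> j\<close> with
    \<open>J (z n) < j + 1 / Suc n\<close> and let \<open>n\<close> grow. The remaining quadratic in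
    \<open>t\<close> is nonnegative for every \<open>t\<close>, so its linear coefficient is
    zero.\<close>
  have Re: "Re (cinner y (R v)) = Re (f v)" for v
  proof -
    have "0 \<le> 2 * t * (Re (cinner y (R v)) - Re (f v)) + t\<^sup>2 * (norm (R v))\<^sup>2" for t
    proof (rule LIMSEQ_le_const)
      have "(\<lambda>n. 1 / real (Suc n)) \<longlonglongrightarrow> 0"
        using LIMSEQ_inverse_real_of_nat by (simp add: inverse_eq_divide)
      then have "(\<lambda>n. 1 / real (Suc n) + (2 * t * (Re (cinner (R (z n)) (R v)) - Re (f v)) +
          t\<^sup>2 * (norm (R v))\<^sup>2)) \<longlonglongrightarrow>
          0 + (2 * t * (Re (cinner y (R v)) - Re (f v)) + t\<^sup>2 * (norm (R v))\<^sup>2)"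
        by (intro tendsto_add tendsto_mult tendsto_diff tendsto_Re tendsto_const cinner.tendsto y)
      then show "(\<lambda>n. 1 / real (Suc n) + (2 * t * (Re (cinner (R (z n)) (R v)) - Re (f v)) +
          t\<^sup>2 * (norm (R v))\<^sup>2)) \<longlonglongrightarrow>
          2 * t * (Re (cinner y (R v)) - Re (f v)) + t\<^sup>2 * (norm (R v))\<^sup>2"
        by simp
      have "0 \<le> 1 / real (Suc n) + (2 * t * (Re (cinner (R (z n)) (R v)) - Re (f v)) +
          t\<^sup>2 * (norm (R v))\<^sup>2)" for n
        using j_le[of "z n + t *\<^sub>R v"] z[of n] unfolding var by linarith
      then show "\<exists>N. \<forall>n\<ge>N. 0 \<le> 1 / real (Suc n) +
          (2 * t * (Re (cinner (R (z n)) (R v)) - Re (f v)) + t\<^sup>2 * (norm (R v))\<^sup>2)"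
        by blast
    qed
    from linear_perturbation_eq_0[OF _ this] show ?thesis
      by simp
  qed
  have "cinner y (R v) = f v" for v
  proof (rule complex_eqI)
    \<comment> \<open>Multiplying \<open>v\<close> by the imaginary unit turns imaginary parts into
      real ones, up to sign.\<close>
    show "Im (cinner y (R v)) = Im (f v)"
      using Re[of "\<i> *\<^sub>C v"] by (simp add: bounded_operatorsD[OF R] cinner_scaleC_right scale)
  qed (rule Re)
  moreover have "y \<in> closure (range R)"
    unfolding closure_sequential by (rule exI[of _ "\<lambda>n. R (z n)"]) (simp add: y)
  ultimately show thesis
    using that by simp
qed

text \<open>For fixed \<open>x\<close>, the functional \<open>z \<mapsto> cinner x (T z)\<close> is
  bounded by a multiple of \<open>norm (R z)\<close>, so \<open>riesz_range\<close> yields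
  \<open>C x\<close>. Its uniqueness in the closed range makes \<open>C\<close> linear. In terms of
  adjoints, \<open>adj R o\<^sub>L C = adj T\<close>.\<close>

lemma factor_exists:
  fixes T R :: "'a::chilbert_space \<Rightarrow>\<^sub>L 'a"
  assumes R: "R \<in> bounded_operators" and T: "T \<in> bounded_operators"
    and bound: "\<And>z. norm (T z) \<le> K * norm (R z)"
  obtains C where "C \<in> bounded_operators" and "\<And>x. C x \<in> closure (range R)"
    and "\<And>x z. cinner (C x) (R z) = cinner x (T z)"
proof -
  have "\<exists>y \<in> closure (range R). \<forall>z. cinner y (R z) = cinner x (T z)" for x
  proof -
    have "cmod (cinner x (T z)) \<le> norm x * K * norm (R z)" for z
    proof -
      have "cmod (cinner x (T z)) \<le> norm x * norm (T z)"
        by (rule cinner_Cauchy_Schwarz)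
      also have "\<dots> \<le> norm x * (K * norm (R z))"
        by (intro mult_left_mono bound norm_ge_zero)
      finally show ?thesis
        by (simp add: mult.assoc)
    qed
    moreover have "cinner x (T (y + z)) = cinner x (T y) + cinner x (T z)" for y z
      by (simp add: blinfun.add_right cinner_add_right)
    moreover have "cinner x (T (c *\<^sub>C z)) = c * cinner x (T z)" for c z
      by (simp add: bounded_operatorsD[OF T] cinner_scaleC_right)
    ultimately obtain y where "y \<in> closure (range R)" "\<And>z. cinner y (R z) = cinner x (T z)"
      using riesz_range[OF R, of "\<lambda>z. cinner x (T z)" "norm x * K"] by metis
    then show ?thesis
      by blast
  qed
  then obtain g where g: "\<And>x. g x \<in> closure (range R)"
    and g': "\<And>x z. cinner (g x) (R z) = cinner x (T z)"
    by metis
  have add: "x + y \<in> closure (range R)" if x: "x \<in> closure (range R)" and y: "y \<in> closure (range R)"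
    for x y
  proof -
    obtain s where s: "\<And>n. s n \<in> range R" "s \<longlonglongrightarrow> x"
      using x unfolding closure_sequential by blast
    obtain t where t: "\<And>n. t n \<in> range R" "t \<longlonglongrightarrow> y"
      using y unfolding closure_sequential by blast
    have "s n + t n \<in> range R" for n
      using s(1)[of n] t(1)[of n] by (auto simp flip: blinfun.add_right)
    with tendsto_add[OF s(2) t(2)] show ?thesis
      unfolding closure_sequential by (intro exI[of _ "\<lambda>n. s n + t n"]) auto
  qed
  have scaleC: "c *\<^sub>C x \<in> closure (range R)" if x: "x \<in> closure (range R)" for c x
  proof -
    obtain s where s: "\<And>n. s n \<in> range R" "s \<longlonglongrightarrow> x"
      using x unfolding closure_sequential by blast
    have "c *\<^sub>C s n \<in> range R" for n
      using s(1)[of n] by (auto simp flip: bounded_operatorsD[OF R])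
    moreover have "(\<lambda>n. c *\<^sub>C s n) \<longlonglongrightarrow> c *\<^sub>C x"
      by (rule bounded_linear.tendsto[OF bounded_linear_scaleC s(2)])
    ultimately show ?thesis
      unfolding closure_sequential by (intro exI[of _ "\<lambda>n. c *\<^sub>C s n"]) auto
  qed
  have g_scaleC: "g (c *\<^sub>C x) = c *\<^sub>C g x" for c x
    by (rule closure_range_orthogonal_eq[where R = "blinfun_apply R"]) (auto simp: g g' scaleC cinner_scaleC_left)
  have "bounded_linear g"
  proof (rule bounded_linear_intro[where K = "\<bar>K\<bar>"])
    show "g (x + y) = g x + g y" for x y
      by (rule closure_range_orthogonal_eq[where R = "blinfun_apply R"])
        (auto simp: g g' cinner_simps add)
    show "g (r *\<^sub>R x) = r *\<^sub>R g x" for r x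
      by (simp add: scaleR_scaleC g_scaleC)
    \<comment> \<open>Only pairings of \<open>g x\<close> with the range of \<open>R\<close> are
      controlled, so \<open>g x\<close> is paired with vectors of the range converging to
      it.\<close>
    show "norm (g x) \<le> norm x * \<bar>K\<bar>" for x
    proof -
      obtain s where s: "\<And>n. s n \<in> range R" "s \<longlonglongrightarrow> g x"
        using g[of x] unfolding closure_sequential by blast
      have le: "cmod (cinner (g x) (s n)) \<le> norm x * \<bar>K\<bar> * norm (s n)" for n
      proof -
        obtain z where "s n = R z"
          using s(1)[of n] by blast
        moreover have "norm (T z) \<le> \<bar>K\<bar> * norm (R z)"
          using bound[of z] by (smt (verit) mult_right_mono norm_ge_zero)
        ultimately show ?thesis
          using order_trans[OF cinner_Cauchy_Schwarz mult_left_mono[of "norm (T z)" _ "norm x"]]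
          by (simp add: g' mult.assoc)
      qed
      have "(\<lambda>n. cmod (cinner (g x) (s n))) \<longlonglongrightarrow> cmod (cinner (g x) (g x))"
        by (intro tendsto_intros cinner.tendsto s(2))
      moreover have "(\<lambda>n. norm x * \<bar>K\<bar> * norm (s n)) \<longlonglongrightarrow> norm x * \<bar>K\<bar> * norm (g x)"
        by (intro tendsto_intros s(2))
      ultimately have "cmod (cinner (g x) (g x)) \<le> norm x * \<bar>K\<bar> * norm (g x)"
        by (rule LIMSEQ_le) (use le in blast)
      then show ?thesis
        using mult_right_le_imp_le[of "norm (g x)" "norm (g x)" "norm x * \<bar>K\<bar>"]
        by (cases "g x = 0") (simp_all add: cinner_self[of "g x"] power2_eq_square norm_mult)
    qed
  qed
  then have app: "blinfun_apply (Blinfun g) = g"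
    by (rule bounded_linear_Blinfun_apply)
  show thesis
    by (rule that[of "Blinfun g"]) (simp_all add: app g g' g_scaleC bounded_operators_def)
qed

section \<open>Adjoints and Douglas factorisation\<close>

text \<open>In the factorisation with \<open>R\<close> the identity, the factor is the
  adjoint.\<close>

lemma adj_exists:
  assumes "A \<in> bounded_operators"
  obtains B where "B \<in> bounded_operators" and "\<And>x y. cinner (B x) y = cinner x (A y)"
  using factor_exists[of id_blinfun A "norm A"] assms
  by (auto simp: bounded_operators_def norm_blinfun)

lemma adj_eqI:
  fixes A B :: "'a::chilbert_space \<Rightarrow>\<^sub>L 'a"
  assumes "\<And>x y. cinner (B x) y = cinner x (A y)"
  shows "adj A = B"
  unfolding adj_def
proof (rule the_equality)
  show "\<forall>x y. cinner (B x) y = cinner x (A y)"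
    using assms by blast
  show "B' = B" if "\<forall>x y. cinner (B' x) y = cinner x (A y)" for B' :: "'a \<Rightarrow>\<^sub>L 'a"
    using that assms by (intro blinfun_eqI cinner_ext_left) simp
qed

lemma adj_in_bounded_operators: "A \<in> bounded_operators \<Longrightarrow> adj A \<in> bounded_operators"
  by (metis adj_eqI adj_exists)

lemma cinner_adj_left: "A \<in> bounded_operators \<Longrightarrow> cinner (adj A x) y = cinner x (A y)"
  by (metis adj_eqI adj_exists)

lemma cinner_adj_right: "A \<in> bounded_operators \<Longrightarrow> cinner x (adj A y) = cinner (A x) y"
  by (metis cinner_adj_left cinner_commute)

lemma adj_adj: "A \<in> bounded_operators \<Longrightarrow> adj (adj A) = A"
  by (rule adj_eqI) (simp add: cinner_adj_right)

lemma adj_compose: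
  "A \<in> bounded_operators \<Longrightarrow> B \<in> bounded_operators \<Longrightarrow> adj (A o\<^sub>L B) = adj B o\<^sub>L adj A"
  by (rule adj_eqI) (simp add: cinner_adj_left)

lemma adj_add:
  "A \<in> bounded_operators \<Longrightarrow> B \<in> bounded_operators \<Longrightarrow> adj (A + B) = adj A + adj B"
  by (rule adj_eqI) (simp add: cinner_adj_left blinfun.bilinear_simps cinner_simps)

lemma adj_diff:
  "A \<in> bounded_operators \<Longrightarrow> B \<in> bounded_operators \<Longrightarrow> adj (A - B) = adj A - adj B"
  by (rule adj_eqI) (simp add: cinner_adj_left blinfun.bilinear_simps cinner_simps)

lemma adj_scaleR: "A \<in> bounded_operators \<Longrightarrow> adj (r *\<^sub>R A) = r *\<^sub>R adj A"
  by (rule adj_eqI) (simp add: cinner_adj_left blinfun.bilinear_simps cinner.scaleR_left cinner.scaleR_right)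

lemma adj_zero: "adj 0 = 0"
  by (rule adj_eqI) (simp add: cinner.zero_left cinner.zero_right)

lemma adj_id: "adj id_blinfun = id_blinfun"
  by (rule adj_eqI) simp

lemma norm_adj_le: "A \<in> bounded_operators \<Longrightarrow> norm (adj A) \<le> norm A"
proof (rule norm_blinfun_bound)
  assume A: "A \<in> bounded_operators"
  show "norm (adj A x) \<le> norm A * norm x" for x
  proof -
    have "(norm (adj A x))\<^sup>2 = cmod (cinner x (A (adj A x)))"
      by (simp add: cinner_self cinner_adj_left[OF A, symmetric] norm_power)
    also have "\<dots> \<le> norm x * (norm A * norm (adj A x))"
      by (rule order_trans[OF cinner_Cauchy_Schwarz mult_left_mono[OF norm_blinfun norm_ge_zero]])
    finally show ?thesis
      by (cases "adj A x = 0") (auto simp: power2_eq_square mult.assoc mult.commute)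
  qed
qed simp

section \<open>Commutants and membership in a von Neumann algebra\<close>

lemma commutantD:
  assumes "B \<in> commutant X" "A \<in> X"
  shows "A (B x) = B (A x)"
proof -
  have "A o\<^sub>L B = B o\<^sub>L A"
    using assms by (simp add: commutant_def)
  then show ?thesis
    by (metis blinfun_apply_blinfun_compose)
qed

lemma commutantI:
  fixes B :: "'a::chilbert_space \<Rightarrow>\<^sub>L 'a" and X :: "('a \<Rightarrow>\<^sub>L 'a) set"
  assumes "B \<in> bounded_operators" "\<And>A x. A \<in> X \<Longrightarrow> A (B x) = B (A x)"
  shows "B \<in> commutant X"
  using assms by (auto simp: commutant_def intro!: blinfun_eqI)

lemma scaleR_scaleC_commute: "c *\<^sub>C r *\<^sub>R x = r *\<^sub>R c *\<^sub>C (x :: 'a::complex_vector)"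
  by (simp add: scaleR_scaleC scaleC_scaleC mult.commute)

lemma scaleC_diff: "c *\<^sub>C (x - y) = c *\<^sub>C x - c *\<^sub>C (y :: 'a::complex_vector)"
  by (metis add_diff_cancel diff_add_cancel scaleC_add_right)

lemma scaleC_zero: "c *\<^sub>C 0 = (0 :: 'a::complex_vector)"
  by (metis diff_self scaleC_diff)

lemma commutant_subset: "commutant X \<subseteq> bounded_operators"
  by (auto simp: commutant_def)

lemma bounded_operators_closed:
  shows "closed (bounded_operators :: ('a::chilbert_space \<Rightarrow>\<^sub>L 'a) set)"
proof -
  have "closed {A :: 'a \<Rightarrow>\<^sub>L 'a. A (c *\<^sub>C x) - c *\<^sub>C A x = 0}" for c x
    by (intro closed_Collect_eq continuous_intros
        bounded_linear.continuous_on[OF bounded_linear_scaleC])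
  then have "closed (\<Inter>c. \<Inter>x. {A :: 'a \<Rightarrow>\<^sub>L 'a. A (c *\<^sub>C x) - c *\<^sub>C A x = 0})"
    by blast
  then show ?thesis
    unfolding bounded_operators_def by (simp add: Collect_all_eq)
qed

lemma commutant_closed: "closed (commutant X)"
proof -
  have "closed {B. A o\<^sub>L B = B o\<^sub>L A}" for A :: "'a \<Rightarrow>\<^sub>L 'a"
    by (intro closed_Collect_eq continuous_intros
        bounded_bilinear.continuous_on[OF bounded_bilinear_blinfun_compose])
  then have "closed (bounded_operators \<inter> (\<Inter>A\<in>X. {B. A o\<^sub>L B = B o\<^sub>L A}))"
    by (intro closed_Int closed_INT bounded_operators_closed) blast
  then show ?thesis
    by (rule back_subst[of closed]) (auto simp: commutant_def)
qed

locale von_neumann =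
  fixes M :: "('h::chilbert_space \<Rightarrow>\<^sub>L 'h) set"
  assumes vN: "von_neumann_algebra M"
begin

lemma bounded: "A \<in> M \<Longrightarrow> A \<in> bounded_operators"
  using vN by (auto simp: von_neumann_algebra_def)

lemma bicommutant: "commutant (commutant M) = M"
  using vN by (simp add: von_neumann_algebra_def)

text \<open>By the double commutant condition, membership is commutation with every \<open>U\<close>
  in the commutant. This is how operators built vector by vector are shown to belong to
  \<open>M\<close>.\<close>

lemma memI:
  assumes "A \<in> bounded_operators" "\<And>U x. U \<in> commutant M \<Longrightarrow> U (A x) = A (U x)"
  shows "A \<in> M"
  using commutantI[of A "commutant M"] assms bicommutant by blast

lemma memD: "A \<in> M \<Longrightarrow> U \<in> commutant M \<Longrightarrow> U (A x) = A (U x)"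
  by (rule commutantD[symmetric])

lemma apply_scaleC: "A \<in> M \<Longrightarrow> A (c *\<^sub>C x) = c *\<^sub>C A x"
  by (simp add: bounded bounded_operatorsD)

lemma adj_mem [simp]: "A \<in> M \<Longrightarrow> adj A \<in> M"
  using vN by (auto simp: von_neumann_algebra_def)

lemma add_mem [simp]: "A \<in> M \<Longrightarrow> B \<in> M \<Longrightarrow> A + B \<in> M"
  by (rule memI) (auto simp: bounded_operators_def blinfun.bilinear_simps memD[of A] memD[of B] scaleC_add_right
      apply_scaleC)

lemma diff_mem [simp]: "A \<in> M \<Longrightarrow> B \<in> M \<Longrightarrow> A - B \<in> M"
  by (rule memI) (auto simp: bounded_operators_def blinfun.bilinear_simps memD[of A] memD[of B] scaleC_diff
      apply_scaleC)

lemma compose_mem [simp]: "A \<in> M \<Longrightarrow> B \<in> M \<Longrightarrow> A o\<^sub>L B \<in> M"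
  by (rule memI) (auto simp: bounded_operators_def memD[of A] memD[of B] apply_scaleC)

lemma scaleR_mem [simp]: "A \<in> M \<Longrightarrow> r *\<^sub>R A \<in> M"
  by (rule memI) (auto simp: bounded_operators_def blinfun.bilinear_simps memD[of A]
      scaleR_scaleC_commute apply_scaleC)

lemma zero_mem [simp]: "0 \<in> M"
  by (rule memI) (auto simp: bounded_operators_def scaleC_zero)

lemma id_mem [simp]: "id_blinfun \<in> M"
  by (rule memI) (auto simp: bounded_operators_def)

lemma closed: "closed M"
  by (metis bicommutant commutant_closed)

text \<open>Take adjoints in the commutation of \<open>U\<close> with \<open>adj A\<close>, which
  lies in \<open>M\<close> too. This lets \<open>U\<close> be moved across inner products in
  \<open>factor\<close>.\<close>

lemma commutant_adj: "U \<in> commutant M \<Longrightarrow> adj U \<in> commutant M"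
proof (rule commutantI)
  assume U: "U \<in> commutant M"
  then have bU: "U \<in> bounded_operators"
    using commutant_subset by blast
  then show "adj U \<in> bounded_operators"
    by (rule adj_in_bounded_operators)
  show "A (adj U x) = adj U (A x)" if A: "A \<in> M" for A x
  proof (rule cinner_ext_left)
    show "cinner (A (adj U x)) z = cinner (adj U (A x)) z" for z
      using memD[of "adj A" U z] U A bounded[OF A] bU
      by (metis adj_mem cinner_adj_left cinner_adj_right)
  qed
qed

text \<open>An operator \<open>U\<close> in the commutant maps the range of \<open>R\<close> into
  itself, hence also its closure. So \<open>U (C x)\<close> and \<open>C (U x)\<close> both lie in
  that closure and pair equally with the range; they agree, and \<open>C \<in> M\<close>.\<close>

lemma factor:
  assumes R: "R \<in> M" and T: "T \<in> M" and "\<And>z. norm (T z) \<le> K * norm (R z)"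
  obtains C where "C \<in> M" and "\<And>x. C x \<in> closure (range R)" and "adj R o\<^sub>L C = adj T"
proof -
  obtain C where C: "C \<in> bounded_operators" "\<And>x. C x \<in> closure (range R)"
    and C': "\<And>x z. cinner (C x) (R z) = cinner x (T z)"
    using factor_exists[OF bounded[OF R] bounded[OF T] assms(3)] by blast
  have "C \<in> M"
  proof (rule memI[OF C(1)])
    fix U x assume U: "U \<in> commutant M"
    then have bU: "U \<in> bounded_operators"
      using commutant_subset by blast
    have inv: "U y \<in> closure (range R)" if "y \<in> closure (range R)" for y
    proof -
      have "U ` range R \<subseteq> closure (range R)"
        by (auto simp: memD[OF R U] intro!: closure_subset[THEN subsetD])
      then have "U ` closure (range R) \<subseteq> closure (range R)"
        by (intro image_closure_subset) (auto intro: linear_continuous_on blinfun.bounded_linear_right)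
      then show ?thesis
        using that by blast
    qed
    have "cinner (U (C x)) (R z) = cinner (C (U x)) (R z)" for z
      by (simp add: C' memD[OF R] memD[OF T] commutant_adj[OF U] cinner_adj_right[OF bU, symmetric])
    then show "U (C x) = C (U x)"
      by (rule closure_range_orthogonal_eq[OF inv[OF C(2)] C(2)])
  qed
  moreover have "adj R o\<^sub>L C = adj T"
    by (intro blinfun_eqI cinner_ext_left)
      (simp add: cinner_adj_left[OF bounded] R T C')
  ultimately show thesis
    using that C(2) by blast
qed

end

section \<open>Range projections\<close>

definition range_projection :: "('a::chilbert_space \<Rightarrow>\<^sub>L 'a) \<Rightarrow> ('a \<Rightarrow>\<^sub>L 'a) \<Rightarrow> bool" where
  "range_projection A P \<longleftrightarrow> P \<in> bounded_operators \<and> adj P = P \<and>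
     (\<forall>x. P x \<in> closure (range A)) \<and> (\<forall>y\<in>closure (range A). P y = y)"

text \<open>Factoring \<open>A\<close> through itself gives
  \<open>adj A o\<^sub>L P = adj A\<close>: \<open>P x\<close> lies in the closed range and
  \<open>x - P x\<close> is orthogonal to it.\<close>

lemma (in von_neumann) range_projection_exists:
  assumes A: "A \<in> M"
  obtains P where "P \<in> M" "range_projection A P"
proof -
  obtain P where P: "P \<in> M" "\<And>x. P x \<in> closure (range A)" "adj A o\<^sub>L P = adj A"
    using factor[OF A A, of 1] by auto
  have orth: "cinner (P x) (A z) = cinner x (A z)" for x z
    using P(3) A by (metis blinfun_apply_blinfun_compose cinner_adj_left bounded)
  have fixed: "P y = y" if "y \<in> closure (range A)" for y
    by (rule closure_range_orthogonal_eq[where R = "blinfun_apply A"]) (auto simp: P that orth)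
  have "cinner (x - P x) (P y) = 0" for x y
    using P(2) by (rule orthogonal_closure) (auto simp: cinner_simps orth)
  then have "cinner x (P y) = cinner (P x) (P y)" for x y
    by (simp add: cinner_simps)
  then have "cinner (P x) y = cinner x (P y)" for x y
    by (metis cinner_commute)
  then have "adj P = P"
    by (rule adj_eqI)
  then show thesis
    using that P fixed bounded by (auto simp: range_projection_def)
qed

section \<open>Range inclusion, Baire category and factorisation\<close>

text \<open>If \<open>A x = B y\<close>, then \<open>cinner z (A x)\<close> is bounded by
  \<open>norm y * norm (adj B z)\<close>, with a constant depending on \<open>x\<close>. The closed
  sets \<open>F n\<close> where \<open>n\<close> serves as constant cover the space, so one of them
  contains a ball, and this makes the constant uniform.\<close>

lemma range_subset_majorization:
  assumes A: "A \<in> bounded_operators" and B: "B \<in> bounded_operators" and sub: "range A \<subseteq> range B"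
  obtains K where "\<And>z. norm (adj A z) \<le> K * norm (adj B z)"
proof -
  define F where "F n = {x. \<forall>z. cmod (cinner z (A x)) \<le> real n * norm (adj B z)}" for n
  have "closed (\<Inter>z. {x. cmod (cinner z (A x)) \<le> real n * norm (adj B z)})" for n
    by (intro closed_INT ballI closed_Collect_le continuous_intros cinner.continuous_on)
  then have closed: "closed (F n)" for n
    unfolding F_def by (simp add: Collect_all_eq)
  have "x \<in> (\<Union>n. F n)" for x
  proof -
    obtain y where y: "A x = B y"
      using sub by blast
    obtain n where n: "norm y \<le> real n"
      using real_arch_simple by blast
    have "cmod (cinner z (A x)) \<le> real n * norm (adj B z)" for z
    proof -
      have "cmod (cinner z (A x)) \<le> norm (adj B z) * norm y"
        unfolding y cinner_adj_left[OF B, symmetric] by (rule cinner_Cauchy_Schwarz)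
      also have "\<dots> \<le> real n * norm (adj B z)"
        using n by (simp add: mult.commute mult_right_mono)
      finally show ?thesis .
    qed
    then show ?thesis
      unfolding F_def by blast
  qed
  then have "\<Union>(range F) = UNIV"
    by blast
  then have "interior (\<Union>(range F)) \<noteq> {}"
    by simp
  then have "\<exists>n. interior (F n) \<noteq> {}"
    using Baire_category_alt[of euclidean "range F"] closed
    by (auto simp: completely_metrizable_space_euclidean)
  then obtain n x0 where "x0 \<in> interior (F n)"
    by blast
  then obtain e where e: "e > 0" "ball x0 e \<subseteq> F n"
    by (auto simp: mem_interior)
  have "norm (adj A z) \<le> (4 * real n / e) * norm (adj B z)" for z
  proof (cases "adj A z = 0")
    case True
    then show ?thesis
      using e(1) by simp
  next
    case False
    \<comment> \<open>This vector of length \<open>e / 2\<close> along \<open>adj A z\<close> keeps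
      \<open>x0 + x\<close> in the ball and makes \<open>cinner z (A x)\<close> equal to
      \<open>e / 2 * norm (adj A z)\<close>. Subtracting the two bounds doubles \<open>n\<close>,
      hence \<open>4 * n / e\<close>.\<close>
    define x where "x = (e / 2 / norm (adj A z)) *\<^sub>R adj A z"
    have "x0 \<in> F n" "x0 + x \<in> F n"
      using e False by (auto intro!: subsetD[OF e(2)] simp: x_def dist_norm)
    then have "cmod (cinner z (A x0)) \<le> real n * norm (adj B z)"
      "cmod (cinner z (A (x0 + x))) \<le> real n * norm (adj B z)"
      by (auto simp: F_def)
    moreover have "cinner z (A x) = cinner z (A (x0 + x)) - cinner z (A x0)"
      by (simp add: blinfun.bilinear_simps cinner_simps)
    ultimately have "cmod (cinner z (A x)) \<le> 2 * real n * norm (adj B z)"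
      using norm_triangle_ineq4[of "cinner z (A (x0 + x))" "cinner z (A x0)"] by simp
    moreover have "cinner z (A x) = of_real (e / 2 * norm (adj A z))"
      using False unfolding cinner_adj_left[OF A, symmetric] x_def
      by (simp add: cinner.scaleR_right cinner_self scaleR_conv_of_real power2_eq_square)
    ultimately have "e / 2 * norm (adj A z) \<le> 2 * real n * norm (adj B z)"
      using e(1) by (simp add: norm_mult norm_divide)
    then show ?thesis
      using e(1) by (simp add: field_simps)
  qed
  then show thesis
    by (rule that)
qed

text \<open>Majorisation of \<open>adj A\<close> by \<open>adj B\<close> is what
  \<open>factor\<close> asks for; its conclusion for these adjoints reads
  \<open>B o\<^sub>L C = A\<close>.\<close>

lemma (in von_neumann) douglas:
  assumes A: "A \<in> M" and B: "B \<in> M" and "range A \<subseteq> range B"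
  obtains C where "C \<in> M" "A = B o\<^sub>L C"
proof -
  obtain K where "\<And>z. norm (adj A z) \<le> K * norm (adj B z)"
    using range_subset_majorization[OF bounded[OF A] bounded[OF B] assms(3)] by blast
  then obtain C where "C \<in> M" "adj (adj B) o\<^sub>L C = adj (adj A)"
    using factor[OF adj_mem[OF B] adj_mem[OF A]] by metis
  then show thesis
    using that A B by (simp add: adj_adj bounded)
qed

section \<open>Square roots\<close>

text \<open>The fixed point of \<open>Y = (c + Y\<^sup>2) / 2\<close> is \<open>1 - S\<close> with \<open>S\<^sup>2 = 1 - c\<close>. The iteration is dominated
  by the scalar one for \<open>c = 1\<close>, which converges.\<close>

primrec sqrt_iter :: "('a::real_normed_vector \<Rightarrow>\<^sub>L 'a) \<Rightarrow> nat \<Rightarrow> 'a \<Rightarrow>\<^sub>L 'a" where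
  "sqrt_iter c 0 = 0"
| "sqrt_iter c (Suc n) = (1 / 2) *\<^sub>R (c + (sqrt_iter c n o\<^sub>L sqrt_iter c n))"

primrec sqrt_majorant :: "nat \<Rightarrow> real" where
  "sqrt_majorant 0 = 0"
| "sqrt_majorant (Suc n) = (1 + (sqrt_majorant n)\<^sup>2) / 2"

lemma sqrt_majorant_bounds: "0 \<le> sqrt_majorant n \<and> sqrt_majorant n \<le> 1"
proof (induction n)
  case (Suc n)
  then have "(sqrt_majorant n)\<^sup>2 \<le> 1"
    by (simp add: power_le_one)
  then show ?case
    by simp
qed simp

lemma convergent_sqrt_majorant: "convergent sqrt_majorant"
proof -
  have "sqrt_majorant n \<le> sqrt_majorant (Suc n)" for n
    using zero_le_power2[of "sqrt_majorant n - 1"] by (simp add: power2_diff)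
  then have "incseq sqrt_majorant"
    by (rule incseq_SucI)
  then show ?thesis
    using sqrt_majorant_bounds by (metis incseq_convergent convergent_def)
qed

lemma norm_sqrt_iter:
  assumes "norm c \<le> 1"
  shows "norm (sqrt_iter c n) \<le> sqrt_majorant n"
proof (induction n)
  case (Suc n)
  have "norm (sqrt_iter c n o\<^sub>L sqrt_iter c n) \<le> sqrt_majorant n * sqrt_majorant n"
    using Suc sqrt_majorant_bounds by (intro order_trans[OF norm_blinfun_compose] mult_mono) auto
  then have "norm (c + (sqrt_iter c n o\<^sub>L sqrt_iter c n)) \<le> 1 + sqrt_majorant n * sqrt_majorant n"
    using assms norm_triangle_ineq[of c "sqrt_iter c n o\<^sub>L sqrt_iter c n"] by linarith
  then show ?case
    by (simp add: power2_eq_square)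
qed simp

interpretation comp: bounded_bilinear "(o\<^sub>L)"
  by (rule bounded_bilinear_blinfun_compose)

text \<open>For consecutive iterates with difference \<open>D = Y' - Y\<close>, the identity
  \<open>Y' Y' - Y Y = Y' D + D Y\<close> holds without commutativity, and the scalar majorant
  satisfies the same recursion with equality.\<close>

lemma norm_sqrt_iter_Suc_diff:
  assumes "norm c \<le> 1"
  shows "norm (sqrt_iter c (Suc n) - sqrt_iter c n) \<le> sqrt_majorant (Suc n) - sqrt_majorant n"
proof (induction n)
  case 0
  then show ?case
    using assms by simp
next
  case (Suc n)
  let ?Y = "sqrt_iter c" and ?t = sqrt_majorant
  let ?D = "?Y (Suc n) - ?Y n" and ?d = "?t (Suc n) - ?t n"
  have d: "0 \<le> ?d"
    using Suc norm_ge_zero order_trans by blast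
  have "?Y (Suc (Suc n)) - ?Y (Suc n) = (1/2) *\<^sub>R ((?Y (Suc n) o\<^sub>L ?Y (Suc n)) - (?Y n o\<^sub>L ?Y n))"
    by (simp only: sqrt_iter.simps(2)[of c "Suc n"] sqrt_iter.simps(2)[of c n]
        scaleR_diff_right[symmetric] add_diff_cancel_left)
  also have "\<dots> = (1/2) *\<^sub>R ((?Y (Suc n) o\<^sub>L ?D) + (?D o\<^sub>L ?Y n))"
    by (simp del: sqrt_iter.simps add: comp.diff_left comp.diff_right)
  also have "norm \<dots> \<le> (1/2) * (norm (?Y (Suc n) o\<^sub>L ?D) + norm (?D o\<^sub>L ?Y n))"
    using norm_triangle_ineq by auto
  also have "\<dots> \<le> (1/2) * (?t (Suc n) * ?d + ?d * ?t n)"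
    using Suc d norm_sqrt_iter[OF assms] sqrt_majorant_bounds[of "Suc n"]
    by (intro mult_left_mono add_mono order_trans[OF norm_blinfun_compose] mult_mono)
      (simp_all del: sqrt_iter.simps sqrt_majorant.simps)
  also have "\<dots> = ?t (Suc (Suc n)) - ?t (Suc n)"
    by (simp only: sqrt_majorant.simps(2)[of "Suc n"]) (simp add: field_simps power2_eq_square)
  finally show ?case .
qed

text \<open>By telescoping, distances between iterates are at most the distances between the
  majorants, which converge.\<close>

lemma convergent_sqrt_iter:
  fixes c :: "'a::banach \<Rightarrow>\<^sub>L 'a"
  assumes "norm c \<le> 1"
  shows "convergent (sqrt_iter c)"
proof -
  have le: "norm (sqrt_iter c (m + k) - sqrt_iter c m) \<le> sqrt_majorant (m + k) - sqrt_majorant m"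
    for m k
  proof (induction k)
    case (Suc k)
    then show ?case
      using norm_sqrt_iter_Suc_diff[OF assms, of "m + k"]
        norm_triangle_ineq[of "sqrt_iter c (m + Suc k) - sqrt_iter c (m + k)"
          "sqrt_iter c (m + k) - sqrt_iter c m"]
      by (simp del: sqrt_iter.simps sqrt_majorant.simps)
  qed simp
  have le': "dist (sqrt_iter c m) (sqrt_iter c n) \<le> dist (sqrt_majorant m) (sqrt_majorant n)" for m n
  proof (cases m n rule: le_cases)
    assume "m \<le> n"
    then show ?thesis
      using \<open>m \<le> n\<close> le[of m "n - m"] by (simp add: dist_norm norm_minus_commute)
  next
    assume "n \<le> m"
    then show ?thesis
      using \<open>n \<le> m\<close> le[of n "m - n"] by (simp add: dist_norm norm_minus_commute)
  qed
  have "Cauchy sqrt_majorant"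
    by (rule convergent_Cauchy[OF convergent_sqrt_majorant])
  then have "Cauchy (sqrt_iter c)"
    unfolding Cauchy_def using le' by (meson order_le_less_trans)
  then show ?thesis
    by (rule Cauchy_convergent)
qed

text \<open>The iterates are self-adjoint elements of the norm-closed \<open>M\<close>, and so is
  their limit \<open>Y\<close>. The fixed-point equation says \<open>c = 2 Y - Y Y\<close>, so
  \<open>1 - Y\<close> squares to \<open>1 - c\<close>.\<close>

lemma (in von_neumann) square_root_exists:
  assumes c: "c \<in> M" "adj c = c" "norm c \<le> 1"
  obtains S where "S \<in> M" "adj S = S" "S o\<^sub>L S = id_blinfun - c"
proof -
  obtain Y where Y: "sqrt_iter c \<longlonglongrightarrow> Y"
    using convergent_sqrt_iter[OF c(3)] by (auto simp: convergent_def)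
  have mem: "sqrt_iter c n \<in> M" for n
    by (induction n) (auto simp: c)
  have self: "adj (sqrt_iter c n) = sqrt_iter c n" for n
    by (induction n) (simp_all add: adj_zero adj_scaleR adj_add adj_compose bounded mem c)
  have YM: "Y \<in> M"
    using closed_sequentially[OF closed] mem Y by blast
  have "(\<lambda>n. sqrt_iter c (Suc n)) \<longlonglongrightarrow> (1/2) *\<^sub>R (c + (Y o\<^sub>L Y))"
    unfolding sqrt_iter.simps by (intro tendsto_intros comp.tendsto Y)
  moreover have "(\<lambda>n. sqrt_iter c (Suc n)) \<longlonglongrightarrow> Y"
    using Y by (rule LIMSEQ_Suc)
  ultimately have fixpoint: "Y = (1/2) *\<^sub>R (c + (Y o\<^sub>L Y))"
    by (rule LIMSEQ_unique[rotated])
  have "adj Y = Y"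
  proof (rule adj_eqI)
    fix x y
    have "(\<lambda>n. cinner (sqrt_iter c n x) y) \<longlonglongrightarrow> cinner (Y x) y"
      by (intro cinner.tendsto blinfun.tendsto Y tendsto_const)
    moreover have "(\<lambda>n. cinner x (sqrt_iter c n y)) \<longlonglongrightarrow> cinner x (Y y)"
      by (intro cinner.tendsto blinfun.tendsto Y tendsto_const)
    moreover have "cinner (sqrt_iter c n x) y = cinner x (sqrt_iter c n y)" for n
      by (metis bounded mem self cinner_adj_left)
    ultimately show "cinner (Y x) y = cinner x (Y y)"
      using LIMSEQ_unique by auto
  qed
  then have "adj (id_blinfun - Y) = id_blinfun - Y"
    using YM by (simp add: adj_diff adj_id bounded)
  moreover have "c + (Y o\<^sub>L Y) = Y + Y"
    by (subst (3 4) fixpoint) (simp flip: scaleR_left_distrib)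
  then have "c = Y + Y - (Y o\<^sub>L Y)"
    by (simp add: eq_diff_eq)
  then have "(id_blinfun - Y) o\<^sub>L (id_blinfun - Y) = id_blinfun - c"
    by (intro blinfun_eqI) (simp add: blinfun.bilinear_simps)
  ultimately show thesis
    using YM by (intro that[of "id_blinfun - Y"]) simp_all
qed

section \<open>Range projections as suprema\<close>

text \<open>Self-adjoint operators have real quadratic forms, so comparing real parts decides the
  order.\<close>

lemma op_leI:
  assumes "S \<in> bounded_operators" "T \<in> bounded_operators" "adj S = S" "adj T = T"
    and "\<And>x. Re (cinner x (S x)) \<le> Re (cinner x (T x))"
  shows "op_le S T"
proof -
  have "Im (cinner x (A x)) = 0" if "A \<in> bounded_operators" "adj A = A"
    for A :: "'a \<Rightarrow>\<^sub>L 'a" and x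
    using cinner_adj_right[OF that(1), of x x] that(2) cinner_commute[of "A x" x]
    by (metis cnj.simps(2) neg_equal_zero)
  moreover have "T - S \<in> bounded_operators"
    using assms(1,2) by (simp add: bounded_operators_def blinfun.diff_left scaleC_diff)
  ultimately show ?thesis
    using assms
    by (simp add: op_le_def positive_op_def complex_nonneg_Reals_iff blinfun.diff_left cinner.diff_right)
qed

lemma op_leD: "op_le S T \<Longrightarrow> Re (cinner x (S x)) \<le> Re (cinner x (T x))"
  by (simp add: op_le_def positive_op_def complex_nonneg_Reals_iff blinfun.diff_left cinner.diff_right)

lemma range_projection_adj_zero:
  assumes "A \<in> bounded_operators" "range_projection A P"
  shows "adj A (x - P x) = 0"
proof -
  have "P (A z) = A z" for z
    using assms(2) closure_subset[of "range A"] by (auto simp: range_projection_def)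
  then have "cinner (x - P x) (A z) = 0" for z
    using assms(2) cinner_adj_left[of P x "A z"] by (simp add: range_projection_def cinner_simps)
  then show ?thesis
    by (metis assms(1) cinner_adj_left cinner_eq_zero_iff)
qed

lemma range_projection_square:
  assumes "range_projection A P"
  shows "cinner x (P x) = of_real ((norm (P x))\<^sup>2)"
proof -
  have "cinner x (P x) = cinner x (P (P x))"
    using assms by (simp add: range_projection_def)
  also have "\<dots> = cinner (P x) (P x)"
    using assms cinner_adj_left[of P x "P x"] by (simp add: range_projection_def)
  finally show ?thesis
    by (simp add: cinner_self)
qed

lemma range_of_range_projection: "range_projection A P \<Longrightarrow> range P = closure (range A)"
  unfolding range_projection_def by (metis image_subset_iff rangeI subsetI subset_antisym)

text \<open>Powers of \<open>1 - A A\<^sup>*\<close> are handled through a self-adjoint root \<open>k\<close>, because the quadratic form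
  of \<open>k\<^bsup>2m\<^esup>\<close> at \<open>x\<close> is then \<open>\<parallel>k\<^bsup>m\<^esup> x\<parallel>\<^sup>2\<close>.\<close>

locale defect_root =
  fixes A k P :: "'a::chilbert_space \<Rightarrow>\<^sub>L 'a"
  assumes A: "A \<in> bounded_operators" and k: "k \<in> bounded_operators" "adj k = k"
    and defect: "k o\<^sub>L k = id_blinfun - (A o\<^sub>L adj A)" and P: "range_projection A P"
begin

lemma k_square: "k (k x) = x - A (adj A x)"
  by (metis defect blinfun.diff_left blinfun_apply_blinfun_compose blinfun_apply_id_blinfun)

lemma norm_k: "(norm (k x))\<^sup>2 = (norm x)\<^sup>2 - (norm (adj A x))\<^sup>2"
proof -
  have "cinner (k x) (k x) = cinner x (k (k x))"
    by (metis cinner_adj_left k)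
  also have "\<dots> = cinner x x - cinner (adj A x) (adj A x)"
    by (simp add: k_square cinner_simps cinner_adj_left[OF A])
  finally have "Re (cinner (k x) (k x)) = Re (cinner x x) - Re (cinner (adj A x) (adj A x))"
    by simp
  then show ?thesis
    by (simp add: cinner_self)
qed

lemma norm_k_le: "norm (k x) \<le> norm x"
  by (rule power2_le_imp_le) (simp_all add: norm_k)

lemma norm_k_pow_le: "norm ((blinfun_apply k ^^ m) x) \<le> norm x"
  by (induction m) (auto intro: order_trans[OF norm_k_le])

lemma cinner_k_pow: "cinner ((blinfun_apply k ^^ m) x) y = cinner x ((blinfun_apply k ^^ m) y)"
proof (induction m arbitrary: y)
  case (Suc m)
  have "cinner ((blinfun_apply k ^^ Suc m) x) y = cinner ((blinfun_apply k ^^ m) x) (k y)"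
    using cinner_adj_left[OF k(1)] k(2) by simp
  then show ?case
    by (simp add: Suc funpow_swap1)
qed simp

lemma k_pow_diff: "(blinfun_apply k ^^ m) (x - y) = (blinfun_apply k ^^ m) x - (blinfun_apply k ^^ m) y"
  by (induction m) (simp_all add: blinfun.diff_right)

lemma k_pow_square: "cinner x ((blinfun_apply k ^^ (2 * m)) x) = of_real ((norm ((blinfun_apply k ^^ m) x))\<^sup>2)"
  unfolding mult_2 funpow_add o_apply by (subst cinner_k_pow[symmetric]) (rule cinner_self)

lemma k_pow_fixed:
  assumes "adj A w = 0"
  shows "(blinfun_apply k ^^ (2 * m)) w = w"
proof -
  have "k (k w) = w"
    by (simp add: k_square assms)
  then show ?thesis
    by (induction m) simp_all
qed

text \<open>Split \<open>x\<close> as \<open>P x + w\<close> with \<open>adj A w = 0\<close>. Even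
  powers of \<open>k\<close> fix \<open>w\<close>, as \<open>k (k w) = w\<close>, whereas
  \<open>k w\<close> may differ from \<open>w\<close>; the cross terms vanish by
  orthogonality.\<close>

lemma quadratic_form:
  "Re (cinner x (x - (blinfun_apply k ^^ (2 * m)) x)) = (norm (P x))\<^sup>2 - (norm ((blinfun_apply k ^^ m) (P x)))\<^sup>2"
proof -
  define y w where "y = P x" and "w = x - P x"
  have w: "adj A w = 0"
    unfolding w_def by (rule range_projection_adj_zero[OF A P])
  have "Re (cinner x (P x)) = (norm y)\<^sup>2"
    using range_projection_square[OF P, of x] by (simp add: y_def)
  have x: "x = y + w"
    by (simp add: y_def w_def)
  have "cinner y w = 0"
    using range_projection_square[OF P, of x] cinner_commute[of "P x" x]
    by (simp add: y_def w_def cinner.diff_right cinner_self)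
  then have "cinner w y = 0"
    by (metis cinner_commute complex_cnj_zero)
  have "cinner w ((blinfun_apply k ^^ (2 * m)) y) = 0"
    by (simp add: cinner_k_pow[symmetric] k_pow_fixed[OF w] \<open>cinner w y = 0\<close>)
  have kx: "(blinfun_apply k ^^ (2 * m)) x = (blinfun_apply k ^^ (2 * m)) y + w"
    using k_pow_diff[of "2 * m" x w] by (simp add: k_pow_fixed[OF w] x)
  have "cinner x (x - (blinfun_apply k ^^ (2 * m)) x) = cinner (y + w) (y - (blinfun_apply k ^^ (2 * m)) y)"
    unfolding kx by (simp add: x)
  also have "\<dots> = cinner y y - cinner y ((blinfun_apply k ^^ (2 * m)) y)"
    using \<open>cinner w y = 0\<close> \<open>cinner w ((blinfun_apply k ^^ (2 * m)) y) = 0\<close> by (simp add: cinner_simps)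
  finally show ?thesis
    by (simp add: k_pow_square cinner_self y_def)
qed

text \<open>By \<open>norm_k\<close>, the squared norms of these vectors are the successive drops of
  a decreasing sequence bounded below by 0.\<close>

lemma adj_k_pow_tendsto: "(\<lambda>m. adj A ((blinfun_apply k ^^ m) x)) \<longlonglongrightarrow> 0"
proof -
  define a where "a m = (norm ((blinfun_apply k ^^ m) x))\<^sup>2" for m
  have "decseq a"
    by (rule decseq_SucI) (simp add: a_def norm_k)
  then obtain L where "a \<longlonglongrightarrow> L"
    using decseq_convergent[of a 0] by (auto simp: a_def)
  then have "(\<lambda>m. a m - a (Suc m)) \<longlonglongrightarrow> L - L"
    by (intro tendsto_diff LIMSEQ_Suc)
  then have "(\<lambda>m. (norm (adj A ((blinfun_apply k ^^ m) x)))\<^sup>2) \<longlonglongrightarrow> 0"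
    by (simp add: a_def norm_k)
  then have "(\<lambda>m. sqrt ((norm (adj A ((blinfun_apply k ^^ m) x)))\<^sup>2)) \<longlonglongrightarrow> sqrt 0"
    by (rule tendsto_real_sqrt)
  then show ?thesis
    by (simp add: tendsto_norm_zero_iff)
qed

text \<open>For \<open>y = A z\<close>, the squared norm is the pairing of \<open>z\<close> with
  \<open>adj A\<close> applied to \<open>k^(2 m) (A z)\<close>, which tends to 0. Since powers of
  \<open>k\<close> are contractions, this extends to the closure.\<close>

lemma k_pow_tendsto:
  assumes "y \<in> closure (range A)"
  shows "(\<lambda>m. norm ((blinfun_apply k ^^ m) y)) \<longlonglongrightarrow> 0"
proof (rule LIMSEQ_I)
  fix e :: real assume "e > 0"
  then obtain z where z: "dist (A z) y < e / 2"
    using assms by (force simp: closure_approachable dest: spec[of _ "e / 2"])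
  have "(\<lambda>m. adj A ((blinfun_apply k ^^ (2 * m)) (A z))) \<longlonglongrightarrow> 0"
    using LIMSEQ_subseq_LIMSEQ[OF adj_k_pow_tendsto, of "\<lambda>m. 2 * m"]
    by (simp add: strict_mono_def o_def)
  then have "(\<lambda>m. cinner z (adj A ((blinfun_apply k ^^ (2 * m)) (A z)))) \<longlonglongrightarrow> cinner z 0"
    by (intro cinner.tendsto tendsto_const)
  then have "(\<lambda>m. sqrt (cmod (cinner z (adj A ((blinfun_apply k ^^ (2 * m)) (A z)))))) \<longlonglongrightarrow> sqrt (cmod (cinner z 0))"
    by (intro tendsto_intros)
  then have "(\<lambda>m. norm ((blinfun_apply k ^^ m) (A z))) \<longlonglongrightarrow> 0"
    by (simp add: cinner_adj_right[OF A] k_pow_square cinner.zero_right norm_power)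
  then obtain m0 where m0: "\<And>m. m \<ge> m0 \<Longrightarrow> norm ((blinfun_apply k ^^ m) (A z)) < e / 2"
    using \<open>e > 0\<close> by (force dest: LIMSEQ_D[of _ _ "e / 2"])
  have "norm ((blinfun_apply k ^^ m) y) < e" if "m \<ge> m0" for m
  proof -
    have "norm ((blinfun_apply k ^^ m) y) \<le> norm ((blinfun_apply k ^^ m) (A z)) + norm ((blinfun_apply k ^^ m) (A z - y))"
      using norm_triangle_ineq4[of "(blinfun_apply k ^^ m) (A z)" "(blinfun_apply k ^^ m) (A z - y)"] by (simp add: k_pow_diff)
    also have "\<dots> < e / 2 + e / 2"
      using m0[OF that] z norm_k_pow_le[of m "A z - y"] by (simp add: dist_norm)
    finally show ?thesis
      by simp
  qed
  then show "\<exists>m0. \<forall>m\<ge>m0. norm (norm ((blinfun_apply k ^^ m) y) - 0) < e"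
    by auto
qed

end

definition blinfun_pow :: "('a::real_normed_vector \<Rightarrow>\<^sub>L 'a) \<Rightarrow> nat \<Rightarrow> 'a \<Rightarrow>\<^sub>L 'a" where
  "blinfun_pow k n = ((o\<^sub>L) k ^^ n) id_blinfun"

lemma blinfun_pow_0 [simp]: "blinfun_pow k 0 = id_blinfun"
  and blinfun_pow_Suc [simp]: "blinfun_pow k (Suc n) = k o\<^sub>L blinfun_pow k n"
  by (simp_all add: blinfun_pow_def)

lemma blinfun_pow_apply: "blinfun_apply (blinfun_pow k n) = blinfun_apply k ^^ n"
  by (induction n) (auto simp: fun_eq_iff)

lemma (in von_neumann) blinfun_pow_mem [simp]: "k \<in> M \<Longrightarrow> blinfun_pow k n \<in> M"
  by (induction n) simp_all

context defect_root
begin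

text \<open>As \<open>k o\<^sub>L k\<close> is \<open>1 - A (adj A)\<close>, this is
  \<open>1 - (1 - A (adj A))^m\<close>, the increasing sequence whose supremum is
  \<open>P\<close>.\<close>

definition approx :: "nat \<Rightarrow> 'a \<Rightarrow>\<^sub>L 'a" where
  "approx m = id_blinfun - blinfun_pow k (2 * m)"

lemma approx_form:
  "Re (cinner x (approx m x)) = (norm (P x))\<^sup>2 - (norm ((blinfun_apply k ^^ m) (P x)))\<^sup>2"
  using quadratic_form by (simp add: approx_def blinfun.diff_left blinfun_pow_apply)

lemma approx_self_adjoint: "self_adjoint (approx m)"
proof -
  have "adj (approx m) = approx m"
    by (rule adj_eqI) (simp add: approx_def blinfun.diff_left blinfun_pow_apply cinner_simps cinner_k_pow)
  moreover have "(blinfun_apply k ^^ n) (c *\<^sub>C x) = c *\<^sub>C (blinfun_apply k ^^ n) x" for n c x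
    by (induction n) (simp_all add: bounded_operatorsD[OF k(1)])
  ultimately show ?thesis
    by (simp add: self_adjoint_def bounded_operators_def approx_def blinfun.diff_left
        blinfun_pow_apply scaleC_diff)
qed

lemma approx_mono: "m \<le> n \<Longrightarrow> op_le (approx m) (approx n)"
proof (rule op_leI)
  fix x
  assume "m \<le> n"
  then obtain j where "n = m + j"
    using le_Suc_ex by blast
  then have "(norm ((blinfun_apply k ^^ n) (P x)))\<^sup>2 \<le> (norm ((blinfun_apply k ^^ m) (P x)))\<^sup>2"
    using norm_k_pow_le[of j "(blinfun_apply k ^^ m) (P x)"]
    by (intro power_mono) (simp_all add: funpow_add add.commute[of m])
  then show "Re (cinner x (approx m x)) \<le> Re (cinner x (approx n x))"
    by (simp add: approx_form)
qed (use approx_self_adjoint in \<open>auto simp: self_adjoint_def\<close>)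

lemma approx_le: "op_le (approx m) P"
proof (rule op_leI)
  show "Re (cinner x (approx m x)) \<le> Re (cinner x (P x))" for x
    by (simp add: approx_form range_projection_square[OF P])
qed (use approx_self_adjoint P in \<open>auto simp: self_adjoint_def range_projection_def\<close>)

text \<open>\<open>k^m (P x)\<close> tends to 0, so the quadratic forms of the approximants converge
  pointwise to that of \<open>P\<close>.\<close>

lemma approx_least:
  assumes T: "self_adjoint T" and le: "\<And>m. op_le (approx m) T"
  shows "op_le P T"
proof (rule op_leI)
  fix x
  have "(\<lambda>m. norm ((blinfun_apply k ^^ m) (P x))) \<longlonglongrightarrow> 0"
    using P by (intro k_pow_tendsto) (simp add: range_projection_def)
  then have "(\<lambda>m. (norm (P x))\<^sup>2 - (norm ((blinfun_apply k ^^ m) (P x)))\<^sup>2) \<longlonglongrightarrow> (norm (P x))\<^sup>2 - 0\<^sup>2"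
    by (intro tendsto_intros)
  then have "(norm (P x))\<^sup>2 - 0\<^sup>2 \<le> Re (cinner x (T x))"
    by (rule LIMSEQ_le_const2) (metis approx_form le op_leD)
  then show "Re (cinner x (P x)) \<le> Re (cinner x (T x))"
    by (simp add: range_projection_square[OF P])
qed (use T P in \<open>auto simp: self_adjoint_def range_projection_def\<close>)

end

section \<open>Sums and intersections of ranges\<close>

text \<open>Operators can thus be rescaled to contractions without changing their ranges.\<close>

lemma range_scaleR:
  fixes A :: "'a::real_normed_vector \<Rightarrow>\<^sub>L 'a"
  assumes "r \<noteq> 0"
  shows "range (r *\<^sub>R A) = range A"
proof -
  have "A x = (r *\<^sub>R A) ((1 / r) *\<^sub>R x)" "(r *\<^sub>R A) x = A (r *\<^sub>R x)" for x
    using assms by (simp_all add: blinfun.scaleR_left blinfun.scaleR_right)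
  then show ?thesis
    by blast
qed

lemma range_projection_fixed: "range_projection A P \<Longrightarrow> P (A x) = A x"
  unfolding range_projection_def by (meson closure_subset rangeI subset_iff)

lemma eq_on_closure_range:
  fixes A B C :: "'a::real_normed_vector \<Rightarrow>\<^sub>L 'a"
  assumes "\<And>x. B (A x) = C (A x)" "y \<in> closure (range A)"
  shows "B y = C y"
proof -
  have "closed {y. B y = C y}"
    by (intro closed_Collect_eq continuous_intros)
  moreover have "range A \<subseteq> {y. B y = C y}"
    using assms(1) by auto
  ultimately show ?thesis
    using assms(2) closure_minimal by blast
qed

text \<open>The kernel of a self-adjoint \<open>S\<close> is orthogonal to its range, so
  \<open>S\<close> is injective on the closed range.\<close>

lemma range_projection_injective:
  assumes "S \<in> bounded_operators" "adj S = S" "range_projection S P" "S x = 0" "P x = x"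
  shows "x = 0"
proof -
  have "x \<in> closure (range S)"
    using assms(3,5) unfolding range_projection_def by metis
  moreover have "cinner x (S z) = 0" for z
    by (metis assms(1,2,4) cinner_adj_left cinner.zero_left)
  ultimately have "cinner x x = 0"
    by (auto intro: orthogonal_closure)
  then show ?thesis
    by (simp add: cinner_eq_zero_iff)
qed

text \<open>The relations below determine both \<open>range A + range B\<close> and \<open>range A \<inter> range B\<close>, and they are
  preserved by every \<open>*\<close>-homomorphism that respects range projections. One may think of \<open>(C, D)\<close> as the
  partial isometry in the polar decomposition of the row operator \<open>(A, B)\<close>.\<close>

definition joint_polar ::
  "('a::chilbert_space \<Rightarrow>\<^sub>L 'a) \<Rightarrow> ('a \<Rightarrow>\<^sub>L 'a) \<Rightarrow> ('a \<Rightarrow>\<^sub>L 'a) \<Rightarrow> ('a \<Rightarrow>\<^sub>L 'a) \<Rightarrow> ('a \<Rightarrow>\<^sub>L 'a) \<Rightarrow>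
    ('a \<Rightarrow>\<^sub>L 'a) \<Rightarrow> bool" where
  "joint_polar A B S C D P \<longleftrightarrow>
     adj S = S \<and> range_projection S P \<and> A = S o\<^sub>L C \<and> B = S o\<^sub>L D \<and> P o\<^sub>L C = C \<and> P o\<^sub>L D = D \<and>
     (C o\<^sub>L adj C) + (D o\<^sub>L adj D) = P"

context
  fixes A B S C D P :: "'a::chilbert_space \<Rightarrow>\<^sub>L 'a"
  assumes S: "S \<in> bounded_operators" and polar: "joint_polar A B S C D P"
begin

lemma joint_polar_apply:
  "A x = S (C x)" "B x = S (D x)" "P (C x) = C x" "P (D x) = D x"
  "C (adj C x) + D (adj D x) = P x" "S (P x) = S x"
proof -
  show "A x = S (C x)" "B x = S (D x)" "P (C x) = C x" "P (D x) = D x"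
    using polar unfolding joint_polar_def by (metis blinfun_apply_blinfun_compose)+
  show "C (adj C x) + D (adj D x) = P x"
    using polar unfolding joint_polar_def by (metis blinfun_apply_blinfun_compose blinfun.add_left)
  show "S (P x) = S x"
    using range_projection_adj_zero[OF S, of P x] polar
    by (simp add: joint_polar_def blinfun.diff_right)
qed

text \<open>\<open>A\<close> and \<open>B\<close> factor through \<open>S\<close>; conversely
  \<open>S = S P = A (adj C) + B (adj D)\<close>.\<close>

lemma joint_polar_range_sum: "range A + range B = range S"
proof
  show "range A + range B \<subseteq> range S"
    by (auto elim!: set_plus_elim simp: joint_polar_apply simp flip: blinfun.add_right)
  show "range S \<subseteq> range A + range B"
  proof
    fix y assume "y \<in> range S"
    then obtain x where "y = S x"
      by blast
    then have "y = A (adj C x) + B (adj D x)"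
      by (simp add: joint_polar_apply flip: blinfun.add_right)
    then show "y \<in> range A + range B"
      by (auto intro: set_plus_intro)
  qed
qed

text \<open>\<open>A x = B y\<close> means that \<open>(x, - y)\<close> lies in the kernel of the row \<open>(C, D)\<close>, and
  \<open>(1 - C\<^sup>* C, - C\<^sup>* D)\<close> is the first row of the projection onto that kernel.\<close>

lemma joint_polar_range_Int:
  "range A \<inter> range B =
     range (A o\<^sub>L (id_blinfun - (adj C o\<^sub>L C))) + range (A o\<^sub>L (adj C o\<^sub>L D))"
proof
  \<comment> \<open>Apply \<open>S (C (adj C) + D (adj D)) = S P\<close> after \<open>C\<close> and
    use \<open>P C = C\<close>; fact \<open>2\<close> does the same after \<open>D\<close>.\<close>
  have 1: "A (x - adj C (C x)) = B (adj D (C x))" for x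
  proof -
    have "S (C (adj C (C x))) + S (D (adj D (C x))) = S (C x)"
      by (simp add: joint_polar_apply flip: blinfun.add_right)
    then show ?thesis
      by (simp add: joint_polar_apply(1,2) blinfun.diff_right algebra_simps)
  qed
  have 2: "A (adj C (D x)) = B (x - adj D (D x))" for x
  proof -
    have "S (C (adj C (D x))) + S (D (adj D (D x))) = S (D x)"
      by (simp add: joint_polar_apply flip: blinfun.add_right)
    then show ?thesis
      by (simp add: joint_polar_apply(1,2) blinfun.diff_right algebra_simps)
  qed
  show "range (A o\<^sub>L (id_blinfun - (adj C o\<^sub>L C))) + range (A o\<^sub>L (adj C o\<^sub>L D)) \<subseteq> range A \<inter> range B"
  proof
    fix v assume "v \<in> range (A o\<^sub>L (id_blinfun - (adj C o\<^sub>L C))) + range (A o\<^sub>L (adj C o\<^sub>L D))"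
    then obtain x y where v: "v = A (x - adj C (C x)) + A (adj C (D y))"
      by (auto elim!: set_plus_elim simp: blinfun.diff_left)
    then have "v = A (x - adj C (C x) + adj C (D y))"
      by (simp add: blinfun.add_right)
    moreover have "v = B (adj D (C x) + (y - adj D (D y)))"
      unfolding v 1 2 by (rule blinfun.add_right[symmetric])
    ultimately show "v \<in> range A \<inter> range B"
      by blast
  qed
  show "range A \<inter> range B \<subseteq> range (A o\<^sub>L (id_blinfun - (adj C o\<^sub>L C))) + range (A o\<^sub>L (adj C o\<^sub>L D))"
  proof
    fix v assume "v \<in> range A \<inter> range B"
    then obtain x y where v: "v = A x" "v = B y"
      by blast
    \<comment> \<open>\<open>S\<close> is injective on its closed range, which contains
      \<open>C x\<close> and \<open>D y\<close>. Once they agree, the correction terms cancel and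
      leave \<open>A x\<close>.\<close>
    have "C x - D y = 0"
    proof (rule range_projection_injective[OF S])
      show "adj S = S" "range_projection S P"
        using polar by (auto simp: joint_polar_def)
      show "S (C x - D y) = 0"
        using v by (simp add: blinfun.diff_right joint_polar_apply(1,2))
      show "P (C x - D y) = C x - D y"
        by (simp add: blinfun.diff_right joint_polar_apply)
    qed
    then have "v = A (x - adj C (C x)) + A (adj C (D y))"
      using v by (simp add: blinfun.diff_right)
    then have "v = (A o\<^sub>L (id_blinfun - (adj C o\<^sub>L C))) x + (A o\<^sub>L (adj C o\<^sub>L D)) y"
      by (simp add: blinfun.diff_left)
    then show "v \<in> range (A o\<^sub>L (id_blinfun - (adj C o\<^sub>L C))) + range (A o\<^sub>L (adj C o\<^sub>L D))"
      by (simp add: set_plus_intro)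
  qed
qed

end

section \<open>Existence of the joint polar data\<close>

text \<open>With \<open>S S = A (adj A) + B (adj B)\<close>, the square of \<open>norm (S x)\<close>
  is the sum of the squares of \<open>norm (adj A x)\<close> and \<open>norm (adj B x)\<close>. So
  \<open>S\<close> majorises both adjoints with constant 1, and \<open>factor\<close> yields
  \<open>C\<close> and \<open>D\<close>.\<close>

lemma (in von_neumann) joint_polar_exists:
  assumes A: "A \<in> M" and B: "B \<in> M" and norms: "norm A \<le> 1" "norm B \<le> 1"
  obtains S C D P where "S \<in> M" "C \<in> M" "D \<in> M" "P \<in> M" "joint_polar A B S C D P"
proof -
  note b = bounded[OF A] bounded[OF B]
  define a where "a = (A o\<^sub>L adj A) + (B o\<^sub>L adj B)"
  have a: "a \<in> M" "adj a = a"
    using A B by (simp_all add: a_def adj_add adj_compose bounded adj_adj)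
  have form: "cinner x (a x) = of_real ((norm (adj A x))\<^sup>2 + (norm (adj B x))\<^sup>2)" for x
    by (simp add: a_def blinfun.add_left cinner_add_right cinner_adj_left[OF b(1), symmetric]
        cinner_adj_left[OF b(2), symmetric] cinner_self[of "adj A x"] cinner_self[of "adj B x"])
  \<comment> \<open>For contractions, \<open>(norm (a x))\<^sup>2\<close> is at most twice
    \<open>cinner x (a x)\<close>; expanding the square of \<open>norm (x - a x)\<close> then gives
    the bound that the square root construction requires.\<close>
  have "norm (id_blinfun - a) \<le> 1"
  proof (rule norm_blinfun_bound)
    fix x
    have "norm (A (adj A x)) \<le> 1 * norm (adj A x)" "norm (B (adj B x)) \<le> 1 * norm (adj B x)"
      by (intro order_trans[OF norm_blinfun] mult_right_mono norms norm_ge_zero)+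
    then have "norm (a x) \<le> norm (adj A x) + norm (adj B x)"
      using norm_triangle_ineq[of "A (adj A x)" "B (adj B x)"] by (simp add: a_def blinfun.add_left)
    then have "(norm (a x))\<^sup>2 \<le> (norm (adj A x) + norm (adj B x))\<^sup>2"
      by (intro power_mono) auto
    also have "\<dots> \<le> 2 * ((norm (adj A x))\<^sup>2 + (norm (adj B x))\<^sup>2)"
      using zero_le_power2[of "norm (adj A x) - norm (adj B x)"]
      by (simp add: power2_sum power2_diff)
    finally have "(norm (x - a x))\<^sup>2 \<le> (norm x)\<^sup>2"
      by (simp add: norm_diff_square form)
    then show "norm ((id_blinfun - a) x) \<le> 1 * norm x"
      by (simp add: blinfun.diff_left power2_le_iff_abs_le)
  qed simp
  moreover have "id_blinfun - a \<in> M" "adj (id_blinfun - a) = id_blinfun - a"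
    using a by (simp_all add: adj_diff adj_id bounded)
  ultimately obtain S where S: "S \<in> M" "adj S = S" "S o\<^sub>L S = id_blinfun - (id_blinfun - a)"
    using square_root_exists[of "id_blinfun - a"] by blast
  then have SS: "S (S x) = a x" for x
    by (metis blinfun_apply_blinfun_compose diff_diff_eq2 add_diff_cancel_left')
  have "cinner (S x) (S x) = cinner x (a x)" for x
    by (metis S(1,2) SS bounded cinner_adj_left)
  then have "(norm (S x))\<^sup>2 = (norm (adj A x))\<^sup>2 + (norm (adj B x))\<^sup>2" for x
    unfolding form cinner_self of_real_eq_iff .
  then have "norm (adj A x) \<le> 1 * norm (S x)" "norm (adj B x) \<le> 1 * norm (S x)" for x
    by (auto intro: power2_le_imp_le)
  then obtain C D where C: "C \<in> M" "\<And>x. C x \<in> closure (range S)" "adj S o\<^sub>L C = adj (adj A)"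
    and D: "D \<in> M" "\<And>x. D x \<in> closure (range S)" "adj S o\<^sub>L D = adj (adj B)"
    using factor[OF S(1) adj_mem[OF A], of 1] factor[OF S(1) adj_mem[OF B], of 1] by metis
  obtain P where P: "P \<in> M" "range_projection S P"
    using range_projection_exists[OF S(1)] .
  have SC: "A = S o\<^sub>L C" "B = S o\<^sub>L D"
    using C D S(2) b by (simp_all add: adj_adj)
  have PC: "P o\<^sub>L C = C" "P o\<^sub>L D = D"
    using C D P by (auto intro!: blinfun_eqI simp: range_projection_def)
  have PP: "P (P x) = P x" "adj P = P" for x
    using P by (auto simp: range_projection_def)
  \<comment> \<open>The defect of the identity still to be proved. \<open>S G S = 0\<close> by the
    choice of \<open>S\<close>, so injectivity gives \<open>G S = 0\<close> and hence
    \<open>G P = 0\<close>; the adjoint of \<open>P G = G\<close> turns this into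
    \<open>G = 0\<close>.\<close>
  define G where "G = (C o\<^sub>L adj C) + (D o\<^sub>L adj D) - P"
  have G: "G \<in> M" "adj G = G"
    using C D P PP by (simp_all add: G_def adj_add adj_diff adj_compose bounded adj_adj)
  have PG: "P (G x) = G x" for x
  proof -
    have "P (C y) = C y" "P (D y) = D y" for y
      using PC by (metis blinfun_apply_blinfun_compose)+
    then show ?thesis
      using PP by (simp add: G_def blinfun.bilinear_simps)
  qed
  have CS: "adj C (S x) = adj A x" "adj D (S x) = adj B x" for x
    using C(1) D(1) S(1,2) by (simp_all add: SC adj_compose bounded)
  have "G (S x) = 0" for x
  proof (rule range_projection_injective[OF bounded[OF S(1)] S(2) P(2)])
    have "S (G (S x)) = A (adj A x) + B (adj B x) - S (S x)"
      using range_projection_fixed[OF P(2)] by (simp add: G_def blinfun.bilinear_simps CS) (simp add: SC)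
    then show "S (G (S x)) = 0"
      by (simp add: SS a_def blinfun.add_left)
  qed (rule PG)
  then have "G (P x) = 0" for x
    using eq_on_closure_range[of G S 0 "P x"] P(2) by (simp add: range_projection_def)
  moreover have "P o\<^sub>L G = G"
    by (rule blinfun_eqI) (simp add: PG)
  then have "G o\<^sub>L P = G"
    by (metis G PP(2) P(1) adj_compose bounded)
  ultimately have "G = 0"
    by (metis blinfun_eqI blinfun_apply_blinfun_compose blinfun.zero_left)
  then have "joint_polar A B S C D P"
    using S P SC PC by (simp add: joint_polar_def G_def)
  with S C D P that show thesis
    by blast
qed

section \<open>Ranges under a normal star homomorphism\<close>

locale normal_star_hom = dom: von_neumann M + cod: von_neumann N
  for M :: "('h::chilbert_space \<Rightarrow>\<^sub>L 'h) set" and N :: "('k::chilbert_space \<Rightarrow>\<^sub>L 'k) set" +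
  fixes \<Phi> :: "('h \<Rightarrow>\<^sub>L 'h) \<Rightarrow> ('k \<Rightarrow>\<^sub>L 'k)"
  assumes star_hom: "unital_star_hom M N \<Phi>" and normal: "normal_map M N \<Phi>"
begin

lemma hom_mem [simp]: "A \<in> M \<Longrightarrow> \<Phi> A \<in> N"
  using star_hom by (auto simp: unital_star_hom_def)

lemma hom_add: "A \<in> M \<Longrightarrow> B \<in> M \<Longrightarrow> \<Phi> (A + B) = \<Phi> A + \<Phi> B"
  and hom_scaleC: "A \<in> M \<Longrightarrow> \<Phi> (c *\<^sub>C A) = c *\<^sub>C \<Phi> A"
  and hom_compose: "A \<in> M \<Longrightarrow> B \<in> M \<Longrightarrow> \<Phi> (A o\<^sub>L B) = \<Phi> A o\<^sub>L \<Phi> B"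
  and hom_adj: "A \<in> M \<Longrightarrow> \<Phi> (adj A) = adj (\<Phi> A)"
  and hom_id: "\<Phi> id_blinfun = id_blinfun"
  using star_hom by (auto simp: unital_star_hom_def)

lemma hom_scaleR: "A \<in> M \<Longrightarrow> \<Phi> (r *\<^sub>R A) = r *\<^sub>R \<Phi> A"
  by (simp add: scaleR_scaleC hom_scaleC)

lemma hom_diff: "A \<in> M \<Longrightarrow> B \<in> M \<Longrightarrow> \<Phi> (A - B) = \<Phi> A - \<Phi> B"
  using hom_add[of A "- 1 *\<^sub>R B"] hom_scaleR[of B "- 1"] dom.scaleR_mem[of B "- 1"] by simp

lemma hom_zero: "\<Phi> 0 = 0"
  using hom_diff[of 0 0] by simp

lemma hom_pow: "k \<in> M \<Longrightarrow> \<Phi> (blinfun_pow k n) = blinfun_pow (\<Phi> k) n"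
  by (induction n) (simp_all add: hom_id hom_compose)

lemma hom_range_mono:
  assumes "A \<in> M" "B \<in> M" "range A \<subseteq> range B"
  shows "range (\<Phi> A) \<subseteq> range (\<Phi> B)"
proof -
  obtain C where "C \<in> M" "A = B o\<^sub>L C"
    using dom.douglas[OF assms] .
  then show ?thesis
    using assms(2) by (auto simp: hom_compose)
qed

text \<open>\<open>\<Phi>\<close> carries the approximants of \<open>P\<close> to those of the range
  projection \<open>Q\<close> of \<open>\<Phi> A\<close>. By normality their supremum is
  \<open>\<Phi> P\<close>, and \<open>Q\<close> is an upper bound, so \<open>\<Phi> P\<close> is
  below \<open>Q\<close>. That \<open>\<Phi> P\<close> fixes the closed range of
  \<open>\<Phi> A\<close> follows from \<open>P A = A\<close>.\<close>

lemma hom_range_projection_contraction: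
  assumes A: "A \<in> M" "norm A \<le> 1" and P: "P \<in> M" "range_projection A P"
  shows "range_projection (\<Phi> A) (\<Phi> P)"
proof -
  have "norm (A o\<^sub>L adj A) \<le> 1 * 1"
    using A norm_adj_le[OF dom.bounded[OF A(1)]]
    by (intro order_trans[OF norm_blinfun_compose] mult_mono) auto
  then obtain k where k: "k \<in> M" "adj k = k" "k o\<^sub>L k = id_blinfun - (A o\<^sub>L adj A)"
    using dom.square_root_exists[of "A o\<^sub>L adj A"] A by (auto simp: adj_compose dom.bounded adj_adj)
  obtain Q where Q: "Q \<in> N" "range_projection (\<Phi> A) Q"
    using cod.range_projection_exists[OF hom_mem[OF A(1)]] .
  interpret D: defect_root A k P
    by unfold_locales (use A k P in \<open>simp_all add: dom.bounded\<close>)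
  have "\<Phi> k o\<^sub>L \<Phi> k = id_blinfun - (\<Phi> A o\<^sub>L adj (\<Phi> A))"
    using arg_cong[OF k(3), of \<Phi>] A k(1) by (simp add: hom_compose hom_diff hom_id hom_adj)
  then interpret D': defect_root "\<Phi> A" "\<Phi> k" Q
    by unfold_locales (use A k Q in \<open>simp_all add: cod.bounded flip: hom_adj\<close>)
  have approx_mem: "D.approx m \<in> M" for m
    by (simp add: D.approx_def k)
  have hom_approx: "\<Phi> (D.approx m) = D'.approx m" for m
    by (simp add: D.approx_def D'.approx_def hom_diff hom_id hom_pow k)
  have "is_op_sup M (range D.approx) P"
    using P D.approx_le D.approx_least
    by (auto simp: is_op_sup_def self_adjoint_def range_projection_def)
  moreover have "\<exists>C\<in>range D.approx. op_le (D.approx m) C \<and> op_le (D.approx n) C" for m n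
    by (rule bexI[of _ "D.approx (max m n)"]) (simp_all add: D.approx_mono)
  then have "\<forall>A\<in>range D.approx. \<forall>B\<in>range D.approx. \<exists>C\<in>range D.approx. op_le A C \<and> op_le B C"
    by blast
  moreover have "range D.approx \<subseteq> {A \<in> M. self_adjoint A}"
    using approx_mem D.approx_self_adjoint by blast
  ultimately have "is_op_sup N (\<Phi> ` range D.approx) (\<Phi> P)"
    using normal[unfolded normal_map_def, THEN spec, THEN spec, THEN mp] by simp
  moreover have "\<forall>B\<in>\<Phi> ` range D.approx. op_le B Q"
    by (auto simp: hom_approx D'.approx_le)
  ultimately have le: "op_le (\<Phi> P) Q"
    using Q by (auto simp: is_op_sup_def self_adjoint_def range_projection_def)
  have "P o\<^sub>L A = A" "P o\<^sub>L P = P" "adj P = P"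
    using P(2) by (auto intro!: blinfun_eqI simp: range_projection_fixed) (auto simp: range_projection_def)
  then have hP: "\<Phi> P o\<^sub>L \<Phi> A = \<Phi> A" "\<Phi> P o\<^sub>L \<Phi> P = \<Phi> P" "adj (\<Phi> P) = \<Phi> P"
    using A P by (metis hom_compose hom_adj)+
  have "\<Phi> P x \<in> closure (range (\<Phi> A))" for x
  proof -
    define y where "y = \<Phi> P x"
    have "\<Phi> P y = y"
      unfolding y_def by (metis hP(2) blinfun_apply_blinfun_compose)
    \<comment> \<open>The operator inequality, evaluated at a vector fixed by
      \<open>\<Phi> P\<close>. An orthogonal projection that does not shorten \<open>y\<close> fixes
      it.\<close>
    then have "(norm y)\<^sup>2 \<le> (norm (Q y))\<^sup>2"
      using op_leD[OF le, of y] by (simp add: range_projection_square[OF Q(2)] cinner_self)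
    then have "(norm (y - Q y))\<^sup>2 \<le> 0"
      by (simp add: norm_diff_square range_projection_square[OF Q(2)])
    then have "y = Q y"
      by simp
    moreover have "Q y \<in> closure (range (\<Phi> A))"
      using Q(2) by (simp add: range_projection_def)
    ultimately show ?thesis
      by (simp add: y_def)
  qed
  moreover have "\<Phi> P y = y" if "y \<in> closure (range (\<Phi> A))" for y
    using eq_on_closure_range[of "\<Phi> P" "\<Phi> A" id_blinfun y] that hP(1)
    by (metis blinfun_apply_blinfun_compose blinfun_apply_id_blinfun)
  ultimately show ?thesis
    using P hP by (simp add: range_projection_def cod.bounded)
qed

lemma hom_range_projection:
  assumes A: "A \<in> M" and P: "P \<in> M" "range_projection A P"
  shows "range_projection (\<Phi> A) (\<Phi> P)"
proof -
  \<comment> \<open>The \<open>1 +\<close> keeps the denominator positive when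
    \<open>A = 0\<close>.\<close>
  define r where "r = 1 / (1 + norm A)"
  have pos: "0 < 1 + norm A"
    using norm_ge_zero[of A] by linarith
  then have r: "r \<noteq> 0"
    by (simp add: r_def)
  have "norm (r *\<^sub>R A) \<le> 1"
    using pos by (simp add: r_def)
  moreover have "range_projection (r *\<^sub>R A) P"
    using P(2) by (simp add: range_projection_def range_scaleR[OF r])
  ultimately have "range_projection (\<Phi> (r *\<^sub>R A)) (\<Phi> P)"
    using hom_range_projection_contraction A P(1) by simp
  then show ?thesis
    by (simp add: hom_scaleR[OF A] range_projection_def range_scaleR[OF r])
qed

lemma hom_joint_polar:
  assumes "S \<in> M" "C \<in> M" "D \<in> M" "P \<in> M" and polar: "joint_polar A B S C D P"
  shows "joint_polar (\<Phi> A) (\<Phi> B) (\<Phi> S) (\<Phi> C) (\<Phi> D) (\<Phi> P)"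
  using assms hom_range_projection[of S P] unfolding joint_polar_def
  by (metis hom_compose hom_adj hom_add dom.adj_mem dom.compose_mem)

lemma scaled_joint_polar_exists:
  assumes A: "A \<in> M" and B: "B \<in> M"
  obtains r S C D P where "r \<noteq> 0" "S \<in> M" "C \<in> M" "D \<in> M" "P \<in> M"
    "joint_polar (r *\<^sub>R A) (r *\<^sub>R B) S C D P"
proof -
  define r where "r = 1 / (1 + norm A + norm B)"
  have pos: "0 < 1 + norm A + norm B"
    using norm_ge_zero[of A] norm_ge_zero[of B] by linarith
  then have "r \<noteq> 0"
    by (simp add: r_def)
  moreover have "norm (r *\<^sub>R A) \<le> 1" "norm (r *\<^sub>R B) \<le> 1"
    using pos by (simp_all add: r_def)
  ultimately show thesis
    using dom.joint_polar_exists[of "r *\<^sub>R A" "r *\<^sub>R B"] A B that by (metis dom.scaleR_mem)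
qed

text \<open>\<open>\<Phi>\<close> transports the joint polar relations of the rescaled operators, so
  the sum formula holds on both sides with the same \<open>S\<close>.\<close>

lemma range_sum:
  assumes A: "A \<in> M" and B: "B \<in> M"
  obtains S where "S \<in> M" "range A + range B = range S" "range (\<Phi> A) + range (\<Phi> B) = range (\<Phi> S)"
proof -
  obtain r S C D P where r: "r \<noteq> 0" and *: "S \<in> M" "C \<in> M" "D \<in> M" "P \<in> M"
    "joint_polar (r *\<^sub>R A) (r *\<^sub>R B) S C D P"
    using scaled_joint_polar_exists[OF A B] .
  have "joint_polar (r *\<^sub>R \<Phi> A) (r *\<^sub>R \<Phi> B) (\<Phi> S) (\<Phi> C) (\<Phi> D) (\<Phi> P)"
    using hom_joint_polar[OF *] A B by (simp add: hom_scaleR)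
  then have "range (r *\<^sub>R \<Phi> A) + range (r *\<^sub>R \<Phi> B) = range (\<Phi> S)"
    by (rule joint_polar_range_sum[rotated]) (simp add: cod.bounded *)
  moreover have "range (r *\<^sub>R A) + range (r *\<^sub>R B) = range S"
    using *(5) by (rule joint_polar_range_sum[rotated]) (simp add: dom.bounded *)
  ultimately show thesis
    using that * by (simp add: range_scaleR[OF r])
qed

text \<open>The intersection is the sum of the ranges of \<open>X\<close> and \<open>Y\<close>,
  whose defining formulas \<open>\<Phi>\<close> preserves; \<open>range_sum\<close> turns that sum
  into a single range.\<close>

lemma range_Int:
  assumes A: "A \<in> M" and B: "B \<in> M"
  obtains S where "S \<in> M" "range A \<inter> range B = range S" "range (\<Phi> A) \<inter> range (\<Phi> B) = range (\<Phi> S)"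
proof -
  obtain r S C D P where r: "r \<noteq> 0" and *: "S \<in> M" "C \<in> M" "D \<in> M" "P \<in> M"
    "joint_polar (r *\<^sub>R A) (r *\<^sub>R B) S C D P"
    using scaled_joint_polar_exists[OF A B] .
  define X Y where "X = r *\<^sub>R A o\<^sub>L (id_blinfun - (adj C o\<^sub>L C))" and "Y = r *\<^sub>R A o\<^sub>L (adj C o\<^sub>L D)"
  have XY: "X \<in> M" "Y \<in> M"
    using A * by (simp_all add: X_def Y_def)
  have hXY: "\<Phi> X = r *\<^sub>R \<Phi> A o\<^sub>L (id_blinfun - (adj (\<Phi> C) o\<^sub>L \<Phi> C))"
      "\<Phi> Y = r *\<^sub>R \<Phi> A o\<^sub>L (adj (\<Phi> C) o\<^sub>L \<Phi> D)"
    using A * by (simp_all add: X_def Y_def hom_compose hom_diff hom_id hom_adj hom_scaleR)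
  have "joint_polar (r *\<^sub>R \<Phi> A) (r *\<^sub>R \<Phi> B) (\<Phi> S) (\<Phi> C) (\<Phi> D) (\<Phi> P)"
    using hom_joint_polar[OF *] A B by (simp add: hom_scaleR)
  then have "range (r *\<^sub>R \<Phi> A) \<inter> range (r *\<^sub>R \<Phi> B) = range (\<Phi> X) + range (\<Phi> Y)"
    unfolding hXY by (rule joint_polar_range_Int[rotated]) (simp add: cod.bounded *)
  moreover have "range (r *\<^sub>R A) \<inter> range (r *\<^sub>R B) = range X + range Y"
    unfolding X_def Y_def using *(5) by (rule joint_polar_range_Int[rotated]) (simp add: dom.bounded *)
  moreover obtain T where "T \<in> M" "range X + range Y = range T" "range (\<Phi> X) + range (\<Phi> Y) = range (\<Phi> T)"
    using range_sum[OF XY] .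
  ultimately show thesis
    using that by (simp add: range_scaleR[OF r])
qed

lemma range_closure:
  assumes A: "A \<in> M"
  obtains P where "P \<in> M" "closure (range A) = range P" "closure (range (\<Phi> A)) = range (\<Phi> P)"
proof -
  obtain P where P: "P \<in> M" "range_projection A P"
    using dom.range_projection_exists[OF A] .
  then show thesis
    using that hom_range_projection[OF A P] by (simp add: range_of_range_projection)
qed

text \<open>The chosen operator has the same range as \<open>A\<close>, so
  \<open>hom_range_mono\<close> in both directions makes the choice immaterial.\<close>

lemma aff_map_range:
  assumes "A \<in> M"
  shows "aff_map M \<Phi> (range A) = range (\<Phi> A)"
proof -
  define B where "B = (SOME B. B \<in> M \<and> range (blinfun_apply B) = range A)"
  have "B \<in> M \<and> range (blinfun_apply B) = range A"
    unfolding B_def by (rule someI[of _ A]) (simp add: assms)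
  then have "range (\<Phi> B) = range (\<Phi> A)"
    using assms by (intro equalityI hom_range_mono) auto
  then show ?thesis
    by (simp add: aff_map_def B_def)
qed

end

section \<open>Affiliated subspaces and the induced lattice map\<close>

lemma (in von_neumann) sum_int_lattice_aff_subspaces: "sum_int_lattice (aff_subspaces M)"
proof -
  \<comment> \<open>The identity is a normal star homomorphism of \<open>M\<close> to itself, so
    \<open>range_sum\<close> and \<open>range_Int\<close> give closure under sums and
    intersections.\<close>
  interpret I: normal_star_hom M M "\<lambda>A. A"
    by unfold_locales (simp_all add: unital_star_hom_def normal_map_def)
  have aff: "V \<in> aff_subspaces M \<longleftrightarrow> (\<exists>A\<in>M. V = range A)" for V
    by (auto simp: aff_subspaces_def)
  have "range A + range B \<in> aff_subspaces M" "range A \<inter> range B \<in> aff_subspaces M"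
    if "A \<in> M" "B \<in> M" for A B
    unfolding aff by (metis I.range_sum[OF that]) (metis I.range_Int[OF that])
  moreover have "subspace (range A)" for A :: "'h \<Rightarrow>\<^sub>L 'h"
    by (intro linear_subspace_image subspace_UNIV bounded_linear.linear blinfun.bounded_linear_right)
  moreover have "c *\<^sub>C v \<in> range A" if "A \<in> M" "v \<in> range A" for A c v
    using that by (auto simp flip: apply_scaleC)
  ultimately show ?thesis
    unfolding sum_int_lattice_def by (auto simp: aff)
qed

theorem theorem3p10:
  fixes M :: "('h::chilbert_space \<Rightarrow>\<^sub>L 'h) set"
    and N :: "('k::chilbert_space \<Rightarrow>\<^sub>L 'k) set"
    and \<Phi> :: "('h \<Rightarrow>\<^sub>L 'h) \<Rightarrow> ('k \<Rightarrow>\<^sub>L 'k)"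
  assumes "von_neumann_algebra M" and "von_neumann_algebra N"
    and "unital_star_hom M N \<Phi>" and "normal_map M N \<Phi>"
  shows
    "((\<forall>A\<in>M. \<forall>B\<in>M. range (blinfun_apply A) = range (blinfun_apply B) \<longrightarrow>
          range (blinfun_apply (\<Phi> A)) = range (blinfun_apply (\<Phi> B))) \<and>
      (\<forall>A\<in>M. aff_map M \<Phi> (range (blinfun_apply A)) = range (blinfun_apply (\<Phi> A))) \<and>
      sum_int_lattice_hom (aff_subspaces M) (aff_subspaces N) (aff_map M \<Phi>)) \<and>
     (aff_map M \<Phi> {0} = {0} \<and> aff_map M \<Phi> UNIV = UNIV) \<and>
     (\<forall>V\<in>aff_subspaces M.
        closure V \<in> aff_subspaces M \<and> aff_map M \<Phi> (closure V) = closure (aff_map M \<Phi> V)) \<and>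
     (\<forall>V\<in>aff_subspaces M. closure V = UNIV \<longrightarrow> closure (aff_map M \<Phi> V) = UNIV) \<and>
     (\<forall>V\<in>aff_subspaces M. \<forall>W\<in>aff_subspaces M.
        V \<subseteq> W \<longrightarrow> aff_map M \<Phi> V \<subseteq> aff_map M \<Phi> W)"
proof -
  interpret normal_star_hom M N \<Phi>
    by unfold_locales (rule assms)+
  have aff: "V \<in> aff_subspaces M \<longleftrightarrow> (\<exists>A\<in>M. V = range A)" for V
    by (auto simp: aff_subspaces_def)
  have maps: "\<forall>A\<in>M. aff_map M \<Phi> (range (blinfun_apply A)) = range (\<Phi> A)"
    by (simp add: aff_map_range)
  have zero: "aff_map M \<Phi> {0} = {0}"
    using aff_map_range[OF dom.zero_mem] by (simp add: hom_zero image_constant_conv)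
  have univ: "aff_map M \<Phi> UNIV = UNIV"
    using aff_map_range[OF dom.id_mem] by (simp add: hom_id)
  have well_defined: "\<forall>A\<in>M. \<forall>B\<in>M. range (blinfun_apply A) = range (blinfun_apply B) \<longrightarrow>
      range (\<Phi> A) = range (\<Phi> B)"
    by (metis aff_map_range)
  have "aff_map M \<Phi> (range A + range B) = aff_map M \<Phi> (range A) + aff_map M \<Phi> (range B)"
    "aff_map M \<Phi> (range A \<inter> range B) = aff_map M \<Phi> (range A) \<inter> aff_map M \<Phi> (range B)"
    if "A \<in> M" "B \<in> M" for A B :: "'h \<Rightarrow>\<^sub>L 'h"
    using range_sum[OF that] range_Int[OF that] that by (metis aff_map_range)+
  then have hom: "sum_int_lattice_hom (aff_subspaces M) (aff_subspaces N) (aff_map M \<Phi>)"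
    using dom.sum_int_lattice_aff_subspaces cod.sum_int_lattice_aff_subspaces
    by (auto simp: sum_int_lattice_hom_def aff aff_map_range) (auto simp: aff_subspaces_def)
  have closure: "\<forall>V\<in>aff_subspaces M.
      closure V \<in> aff_subspaces M \<and> aff_map M \<Phi> (closure V) = closure (aff_map M \<Phi> V)"
  proof
    fix V assume "V \<in> aff_subspaces M"
    then obtain A where A: "A \<in> M" "V = range A"
      by (auto simp: aff)
    obtain P where P: "P \<in> M" "closure (range A) = range P" "closure (range (\<Phi> A)) = range (\<Phi> P)"
      using range_closure[OF A(1)] .
    with A show "closure V \<in> aff_subspaces M \<and> aff_map M \<Phi> (closure V) = closure (aff_map M \<Phi> V)"
      by (auto simp: aff aff_map_range)
  qed
  have mono: "\<forall>V\<in>aff_subspaces M. \<forall>W\<in>aff_subspaces M. V \<subseteq> W \<longrightarrow> aff_map M \<Phi> V \<subseteq> aff_map M \<Phi> W"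
  proof (intro ballI impI)
    fix V W assume "V \<in> aff_subspaces M" "W \<in> aff_subspaces M" "V \<subseteq> W"
    then obtain A B where "A \<in> M" "V = range A" "B \<in> M" "W = range B"
      by (auto simp: aff)
    then show "aff_map M \<Phi> V \<subseteq> aff_map M \<Phi> W"
      using hom_range_mono[of A B] \<open>V \<subseteq> W\<close> by (simp add: aff_map_range)
  qed
  \<comment> \<open>The map commutes with closures and sends the whole space to the whole
    space.\<close>
  have dense: "\<forall>V\<in>aff_subspaces M. closure V = UNIV \<longrightarrow> closure (aff_map M \<Phi> V) = UNIV"
    using closure univ by metis
  show ?thesis
    by (intro conjI well_defined maps zero univ hom closure dense mono)
qed

end
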